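(* Let $(\mathfrak g,J)$ be a $4$-dimensional real Lie algebra endowed with a complex structure. Then: (1) $(\mathfrak g,J)$ admits a taming symplectic form if and only if $(\mathfrak g,J)$ admits a Kähler metric; (2) if $(\mathfrak g,J)$ admits a Kähler metric, then every SKT metric on $(\mathfrak g,J)$ induces a taming symplectic form.
   Context: A complex structure on a real Lie algebra $\mathfrak g$ is a linear map $J:\mathfrak g\to\mathfrak g$ with $J^2=-\mathrm{Id}$ that is integrable, i.e. $J([X,Y]-[JX,JY])-([JX,Y]+[X,JY])=0$ for all $X,Y\in\mathfrak g$. Forms on $\mathfrak g$ are elements of $\Lambda^\bullet\mathfrak g^*$ (or its complexification), equivalently left-invariant forms on the simply connected Lie group with Lie algebra $\mathfrak g$; $d$ is the Chevalley--Eilenberg differential (so $d\alpha(X,Y)=-\alpha([X,Y])$ for a $1$-form $\alpha$), and $d=\partial+\overline\partial$ is its decomposition according to the $(p,q)$-type defined by $J$. A Hermitian metric on $(\mathfrak g,J)$ is an inner product $g$ on $\mathfrak g$ with $g(JX,JY)=g(X,Y)$ for all $X,Y$; its fundamental $2$-form is $\omega(X,Y)=g(JX,Y)$. It is Kähler if $d\omega=0$, and SKT (strong Kähler with torsion) if $\partial\overline\partial\omega=0$. A taming symplectic form on $(\mathfrak g,J)$ is a closed (necessarily non-degenerate) real $2$-form $\Omega\in\Lambda^2\mathfrak g^*$ such that $\Omega(X,JX)>0$ for every non-zero $X\in\mathfrak g$. An SKT metric with fundamental form $\omega$ is said to induce a taming symplectic form if there exists a $(2,0)$-form $\beta$ on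 $\mathfrak g$ with $\partial\beta=0$ and $\partial\omega=\overline\partial\beta$; in this case $\Omega=\omega-\beta-\overline\beta$ is a symplectic form taming $J$. *)

theory Defs
  imports "HOL-Analysis.Analysis"
begin

section \<open>Lie algebras and complex structures\<close>

definition lie_algebra :: "('a::real_vector \<Rightarrow> 'a \<Rightarrow> 'a) \<Rightarrow> bool" where
  "lie_algebra br \<longleftrightarrow>
     bilinear br \<and>
     (\<forall>X. br X X = 0) \<and>
     (\<forall>X Y Z. br X (br Y Z) + br Y (br Z X) + br Z (br X Y) = 0)"

definition complex_structure :: "('a::real_vector \<Rightarrow> 'a \<Rightarrow> 'a) \<Rightarrow> ('a \<Rightarrow> 'a) \<Rightarrow> bool" where
  "complex_structure br J \<longleftrightarrow>
     linear J \<and>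
     (\<forall>X. J (J X) = - X) \<and>
     (\<forall>X Y. J (br X Y - br (J X) (J Y)) - (br (J X) Y + br X (J Y)) = 0)"

section \<open>Exterior forms\<close>

text \<open>
  A form assigns a value to every list of vectors. A \<open>k\<close>-form is an alternating multilinear
  function of lists of length \<open>k\<close>; it is \<open>0\<close> on lists of any other length, so that equality of
  forms is equality of functions. Real forms take values in \<open>real\<close>. The complexified exterior
  algebra is identified with the forms with values in \<open>complex\<close>, which are only real-multilinear
  in their arguments.
\<close>

definition form :: "nat \<Rightarrow> ('a::real_vector list \<Rightarrow> 'b::real_vector) \<Rightarrow> bool" where
  "form k \<alpha> \<longleftrightarrow>
     (\<forall>Xs. length Xs \<noteq> k \<longrightarrow> \<alpha> Xs = 0) \<and>
     (\<forall>Xs i. length Xs = k \<and> i < k \<longrightarrow> linear (\<lambda>X. \<alpha> (Xs[i := X]))) \<and>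
     (\<forall>Xs i j. length Xs = k \<and> i < j \<and> j < k \<and> Xs ! i = Xs ! j \<longrightarrow> \<alpha> Xs = 0)"

definition complex_form :: "('a list \<Rightarrow> real) \<Rightarrow> 'a list \<Rightarrow> complex" where
  "complex_form \<alpha> = (\<lambda>Xs. complex_of_real (\<alpha> Xs))"

text \<open>The Chevalley--Eilenberg differential; \<open>nths Xs (- {i, j})\<close> omits the entries \<open>i\<close> and \<open>j\<close>.\<close>

definition ce_diff ::
    "('a \<Rightarrow> 'a \<Rightarrow> 'a) \<Rightarrow> ('a list \<Rightarrow> 'b::real_vector) \<Rightarrow> 'a list \<Rightarrow> 'b" where
  "ce_diff br \<alpha> Xs =
     (\<Sum>i<length Xs. \<Sum>j\<in>{i<..<length Xs}.
        (-1) ^ (i + j) *\<^sub>R \<alpha> (br (Xs ! i) (Xs ! j) # nths Xs (- {i, j})))"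

section \<open>Types of forms\<close>

text \<open>
  A pair \<open>(X, Y)\<close> stands for the element \<open>X + iY\<close> of the complexified Lie algebra. The
  complex-multilinear extension of \<open>\<alpha>\<close> is obtained by expanding one argument at a time.
\<close>

primrec cext :: "('a \<times> 'a) list \<Rightarrow> ('a list \<Rightarrow> complex) \<Rightarrow> complex" where
  "cext [] \<alpha> = \<alpha> []"
| "cext (Z # Zs) \<alpha> =
     cext Zs (\<lambda>Xs. \<alpha> (fst Z # Xs)) + \<i> * cext Zs (\<lambda>Xs. \<alpha> (snd Z # Xs))"

text \<open>The \<open>i\<close>- and \<open>-i\<close>-eigenspaces of the complex-linear extension of \<open>J\<close>.\<close>

definition T10 :: "('a::real_vector \<Rightarrow> 'a) \<Rightarrow> ('a \<times> 'a) set" where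
  "T10 J = {(X, Y). J X = - Y \<and> J Y = X}"

definition T01 :: "('a::real_vector \<Rightarrow> 'a) \<Rightarrow> ('a \<times> 'a) set" where
  "T01 J = {(X, Y). J X = Y \<and> J Y = - X}"

text \<open>A \<open>(p, q)\<close>-form vanishes on every tuple of vectors of pure type, unless exactly \<open>p\<close> of them
  are of type \<open>(1, 0)\<close> and the other \<open>q\<close> of type \<open>(0, 1)\<close>.\<close>

definition pq_form ::
    "('a::real_vector \<Rightarrow> 'a) \<Rightarrow> nat \<Rightarrow> nat \<Rightarrow> ('a list \<Rightarrow> complex) \<Rightarrow> bool" where
  "pq_form J p q \<alpha> \<longleftrightarrow>
     form (p + q) \<alpha> \<and>
     (\<forall>Zs S. length Zs = p + q \<and> S \<subseteq> {..<p + q} \<and> card S \<noteq> p \<and>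
        (\<forall>i<p + q. Zs ! i \<in> (if i \<in> S then T10 J else T01 J)) \<longrightarrow> cext Zs \<alpha> = 0)"

text \<open>The components \<open>(X - iJX)/2\<close> and \<open>(X + iJX)/2\<close> of a real vector \<open>X\<close>.\<close>

definition vec10 :: "('a::real_vector \<Rightarrow> 'a) \<Rightarrow> 'a \<Rightarrow> 'a \<times> 'a" where
  "vec10 J X = ((1/2) *\<^sub>R X, - ((1/2) *\<^sub>R J X))"

definition vec01 :: "('a::real_vector \<Rightarrow> 'a) \<Rightarrow> 'a \<Rightarrow> 'a \<times> 'a" where
  "vec01 J X = ((1/2) *\<^sub>R X, (1/2) *\<^sub>R J X)"

text \<open>The \<open>(p, q)\<close>-component of a form: split each argument into its components of type \<open>(1, 0)\<close>
  and \<open>(0, 1)\<close>, expand, and keep the terms with exactly \<open>p\<close> arguments of type \<open>(1, 0)\<close>.\<close>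

definition pq_part ::
    "('a::real_vector \<Rightarrow> 'a) \<Rightarrow> nat \<Rightarrow> nat \<Rightarrow> ('a list \<Rightarrow> complex) \<Rightarrow> 'a list \<Rightarrow> complex" where
  "pq_part J p q \<alpha> Xs =
     (if length Xs = p + q then
        \<Sum>S | S \<subseteq> {..<p + q} \<and> card S = p.
          cext (map (\<lambda>i. if i \<in> S then vec10 J (Xs ! i) else vec01 J (Xs ! i)) [0..<p + q]) \<alpha>
      else 0)"

text \<open>
  The operators \<open>\<partial>\<close> and its conjugate send a form of type \<open>(p, q)\<close> to the component of its
  differential of type \<open>(p + 1, q)\<close>, respectively \<open>(p, q + 1)\<close>. On an arbitrary form this is summed
  over the types; on a list of \<open>n\<close> vectors only the types with \<open>p + q + 1 = n\<close> contribute.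
\<close>

definition del ::
    "('a::real_vector \<Rightarrow> 'a \<Rightarrow> 'a) \<Rightarrow> ('a \<Rightarrow> 'a) \<Rightarrow> ('a list \<Rightarrow> complex) \<Rightarrow> 'a list \<Rightarrow> complex" where
  "del br J \<alpha> Xs =
     (\<Sum>(p, q) | p + q + 1 = length Xs. pq_part J (p + 1) q (ce_diff br (pq_part J p q \<alpha>)) Xs)"

definition delbar ::
    "('a::real_vector \<Rightarrow> 'a \<Rightarrow> 'a) \<Rightarrow> ('a \<Rightarrow> 'a) \<Rightarrow> ('a list \<Rightarrow> complex) \<Rightarrow> 'a list \<Rightarrow> complex" where
  "delbar br J \<alpha> Xs =
     (\<Sum>(p, q) | p + q + 1 = length Xs. pq_part J p (q + 1) (ce_diff br (pq_part J p q \<alpha>)) Xs)"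

section \<open>Hermitian metrics and taming symplectic forms\<close>

definition inner_product :: "('a::real_vector \<Rightarrow> 'a \<Rightarrow> real) \<Rightarrow> bool" where
  "inner_product g \<longleftrightarrow> bilinear g \<and> (\<forall>X Y. g X Y = g Y X) \<and> (\<forall>X. X \<noteq> 0 \<longrightarrow> g X X > 0)"

definition hermitian_metric :: "('a::real_vector \<Rightarrow> 'a) \<Rightarrow> ('a \<Rightarrow> 'a \<Rightarrow> real) \<Rightarrow> bool" where
  "hermitian_metric J g \<longleftrightarrow> inner_product g \<and> (\<forall>X Y. g (J X) (J Y) = g X Y)"

definition fundamental_form :: "('a \<Rightarrow> 'a) \<Rightarrow> ('a \<Rightarrow> 'a \<Rightarrow> real) \<Rightarrow> 'a list \<Rightarrow> real" where
  "fundamental_form J g Xs = (case Xs of [X, Y] \<Rightarrow> g (J X) Y | _ \<Rightarrow> 0)"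

definition kahler_metric ::
    "('a::real_vector \<Rightarrow> 'a \<Rightarrow> 'a) \<Rightarrow> ('a \<Rightarrow> 'a) \<Rightarrow> ('a \<Rightarrow> 'a \<Rightarrow> real) \<Rightarrow> bool" where
  "kahler_metric br J g \<longleftrightarrow>
     hermitian_metric J g \<and> ce_diff br (fundamental_form J g) = (\<lambda>_. 0)"

definition skt_metric ::
    "('a::real_vector \<Rightarrow> 'a \<Rightarrow> 'a) \<Rightarrow> ('a \<Rightarrow> 'a) \<Rightarrow> ('a \<Rightarrow> 'a \<Rightarrow> real) \<Rightarrow> bool" where
  "skt_metric br J g \<longleftrightarrow>
     hermitian_metric J g \<and>
     del br J (delbar br J (complex_form (fundamental_form J g))) = (\<lambda>_. 0)"

definition taming_symplectic_form ::
    "('a::real_vector \<Rightarrow> 'a \<Rightarrow> 'a) \<Rightarrow> ('a \<Rightarrow> 'a) \<Rightarrow> ('a list \<Rightarrow> real) \<Rightarrow> bool" where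
  "taming_symplectic_form br J \<Omega> \<longleftrightarrow>
     form 2 \<Omega> \<and> ce_diff br \<Omega> = (\<lambda>_. 0) \<and> (\<forall>X. X \<noteq> 0 \<longrightarrow> \<Omega> [X, J X] > 0)"

definition induces_taming_symplectic_form ::
    "('a::real_vector \<Rightarrow> 'a \<Rightarrow> 'a) \<Rightarrow> ('a \<Rightarrow> 'a) \<Rightarrow> ('a \<Rightarrow> 'a \<Rightarrow> real) \<Rightarrow> bool" where
  "induces_taming_symplectic_form br J g \<longleftrightarrow>
     (\<exists>\<beta>. pq_form J 2 0 \<beta> \<and> del br J \<beta> = (\<lambda>_. 0) \<and>
        del br J (complex_form (fundamental_form J g)) = delbar br J \<beta>)"

end

theory Submission
  imports Defs
begin

text \<open>
  Fix \<open>(1,0)\<close>-forms \<open>h\<close>, \<open>a\<close> spanning the space of \<open>(1,0)\<close>-forms, with \<open>\<partial>h = 0\<close>. Everything is read off the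
  coefficients of \<open>dh\<close> and \<open>da\<close>, which are constrained by the Jacobi identity and by the equation
  that a taming form \<open>\<Omega>\<close> satisfies in bidegree \<open>(2,1)\<close>.

  If the algebra is unimodular, then \<open>dh \<and> \<Omega> = d(h \<and> \<Omega>) = 0\<close> and \<open>dh \<and> d(cnj h) = 0\<close>. The first says that
  the \<open>(1,1)\<close>-form \<open>dh\<close> is primitive for the \<open>(1,1)\<close>-part of \<open>\<Omega>\<close>; the second then forces \<open>dh = 0\<close>.
  If it is not unimodular, then \<open>h\<close> can be chosen as the \<open>(1,0)\<close>-part of the trace form
  \<open>X \<mapsto> tr (ad X)\<close>, and closedness of the trace form makes \<open>dh\<close> imaginary.

  In all cases a shear \<open>a \<mapsto> a + u h\<close> leads to a frame in which a diagonal form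
  \<open>\<i> (x h \<and> cnj h + y a \<and> cnj a)\<close> is Kaehler, and in which \<open>\<partial>\<omega>\<close>, for \<open>\<omega>\<close> of type \<open>(1,1)\<close>, is a multiple of
  the conjugate differential of \<open>h \<and> a\<close> as soon as its coefficient at \<open>h \<and> a \<and> cnj a\<close> vanishes. In the
  unimodular frames it vanishes identically. In the others \<open>\<omega>\<close> has to be SKT: the product of the
  conjugate coefficient with the trace is the coefficient of \<open>\<partial>\<close> of the \<open>(1,2)\<close>-part of \<open>d\<omega>\<close>.
\<close>

section \<open>Coframes of type (1,0)\<close>

definition coframe :: "('a::real_vector \<Rightarrow> 'a) \<Rightarrow> ('a \<Rightarrow> complex) \<Rightarrow> ('a \<Rightarrow> complex) \<Rightarrow> bool" where
  "coframe J h a \<longleftrightarrow> linear h \<and> linear a \<and> (\<forall>X. h (J X) = \<i> * h X) \<and> (\<forall>X. a (J X) = \<i> * a X)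
     \<and> bij (\<lambda>X. (h X, a X))"

text \<open>An infinite-dimensional space has \<open>dim\<close> equal to 0 by default, so the
  positive cardinality of \<open>S\<close> makes the basis \<open>B\<close> finite; an independent
  set then has at most \<open>card B\<close> elements.\<close>

lemma span_eq_UNIV_if_card_eq_dim:
  fixes S :: "'a::real_vector set"
  assumes "independent S" "finite S" "card S = dim (UNIV :: 'a set)" "card S > 0"
  shows "span S = UNIV"
proof (rule ccontr)
  assume "span S \<noteq> UNIV"
  then obtain x where x: "x \<notin> span S" by blast
  obtain B :: "'a set" where B: "independent B" "UNIV \<subseteq> span B" "card B = dim (UNIV :: 'a set)"
    by (rule basis_exists[of "UNIV :: 'a set"])
  have "finite B" using B(3) assms(3,4) by (metis card.infinite less_numeral_extra(3))
  have "independent (insert x S)" using x assms(1) by (simp add: independent_insertI)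
  then have "card (insert x S) \<le> card B"
    using independent_span_bound[OF \<open>finite B\<close>] B(2) by blast
  moreover have "x \<notin> S" using x span_base by blast
  ultimately show False using assms(2,3) B(3) by simp
qed

lemma coframe_exists:
  fixes J :: "'a::real_vector \<Rightarrow> 'a"
  assumes J: "linear J" "\<And>X. J (J X) = - X" and dim: "dim (UNIV :: 'a set) = 4"
  obtains h a where "coframe J h a"
proof -
  \<comment> \<open>Modulo the \<open>J\<close>-invariant subspace \<open>span S\<close> the square
    of \<open>J\<close> is still -1, so \<open>e\<close> is no eigenvector with a real eigenvalue
    \<open>k\<close>: this would give \<open>1 + k*k = 0\<close>.\<close>
  have nospan: "J e \<notin> span (insert e S)" if e: "e \<notin> span S" and S: "J ` S \<subseteq> span S" for e S
  proof
    assume "J e \<in> span (insert e S)"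
    then obtain k where k: "J e - k *\<^sub>R e \<in> span S" using span_breakdown_eq by blast
    have JS: "J v \<in> span S" if "v \<in> span S" for v
      using that S by (metis J(1) imageI linear_span_image span_minimal subsetD subspace_span)
    have "J (J e - k *\<^sub>R e) \<in> span S" using JS k by blast
    then have "- e - k *\<^sub>R J e \<in> span S"
      by (simp add: J linear_diff linear_scale)
    then have "(- e - k *\<^sub>R J e) + k *\<^sub>R (J e - k *\<^sub>R e) \<in> span S"
      using k by (intro span_add span_scale)
    then have "(- (1 + k*k)) *\<^sub>R e \<in> span S" by (simp add: algebra_simps)
    moreover have "- (1 + k*k) \<noteq> 0" by (smt (verit) zero_le_square)
    ultimately have "e \<in> span S"
      using span_scale[of "(- (1 + k*k)) *\<^sub>R e" S "inverse (- (1 + k*k))"] by simp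
    then show False using e by simp
  qed
  have "\<exists>e::'a. e \<noteq> 0"
  proof (rule ccontr)
    assume "\<nexists>e::'a. e \<noteq> 0"
    then have "(UNIV::'a set) = {0}" by auto
    then have "dim (UNIV :: 'a set) = dim (span ({} :: 'a set))" by simp
    also have "\<dots> = 0"
      using dim_eq_card_independent[OF independent_empty] by (simp only: dim_span card.empty)
    finally show False using dim by simp
  qed
  then obtain e :: 'a where e: "e \<notin> span {}" by auto
  have Je: "J e \<notin> span {e}" using nospan[OF e] by simp
  have ind2: "independent {J e, e}" using e Je by (simp add: independent_insertI)
  have ne: "J e \<noteq> e" using Je span_base[of e "{e}"] by auto
  have "span {J e, e} \<noteq> UNIV"
  proof
    assume "span {J e, e} = UNIV"
    then have "dim (UNIV :: 'a set) = dim {J e, e}" by (metis dim_span)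
    also have "\<dots> = 2" using dim_eq_card_independent[OF ind2] ne by simp
    finally have "dim (UNIV :: 'a set) = 2" .
    then show False using dim by simp
  qed
  then obtain f where f: "f \<notin> span {J e, e}" by blast
  have Jf: "J f \<notin> span {f, J e, e}"
    by (rule nospan[OF f]) (auto simp: J(2) span_base span_neg)
  have ind: "independent {J f, f, J e, e}"
    using ind2 f Jf by (simp add: independent_insertI)
  have dist: "J f \<notin> {f, J e, e}" "f \<notin> {J e, e}" "J e \<noteq> e"
    using span_base[of "J f" "{f, J e, e}"] span_base[of f "{J e, e}"] Jf f ne by blast+
  then have "card {J f, f, J e, e} = 4" by simp
  then have sp: "span {J f, f, J e, e} = UNIV"
    using span_eq_UNIV_if_card_eq_dim[OF ind] dim by simp
  \<comment> \<open>Real coordinates in the basis \<open>e\<close>, \<open>J e\<close>,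
    \<open>f\<close>, \<open>J f\<close>, paired to complex ones in which \<open>J\<close> is
    multiplication by \<open>\<i>\<close>.\<close>
  define r where "r = representation {J f, f, J e, e}"
  define h where "h X = Complex (r X e) (r X (J e))" for X
  define a where "a X = Complex (r X f) (r X (J f))" for X
  have rl: "r (X + Y) v = r X v + r Y v" "r (k *\<^sub>R X) v = k * r X v" for X Y v k
    unfolding r_def by (simp_all add: representation_add representation_scale ind sp)
  have rb: "r v w = (if v = w then 1 else 0)" if "v \<in> {J f, f, J e, e}" for v w
    unfolding r_def by (subst representation_basis[OF ind that]) auto
  have ex: "X = r X e *\<^sub>R e + r X (J e) *\<^sub>R J e + r X f *\<^sub>R f + r X (J f) *\<^sub>R J f" for X
  proof -
    have "(\<Sum>b\<in>{J f, f, J e, e}. r X b *\<^sub>R b) = X"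
      unfolding r_def by (rule sum_representation_eq[OF ind]) (auto simp: sp)
    then show ?thesis using dist by (simp add: add.commute add.left_commute)
  qed
  have rs: "r (x1 *\<^sub>R e + x2 *\<^sub>R J e + x3 *\<^sub>R f + x4 *\<^sub>R J f) v =
     x1 * r e v + x2 * r (J e) v + x3 * r f v + x4 * r (J f) v" for x1 x2 x3 x4 v
    by (simp add: rl)
  have hl: "linear h" "linear a"
    by (auto intro!: linearI simp: h_def a_def rl complex_eq_iff)
  have hc: "h (x1 *\<^sub>R e + x2 *\<^sub>R J e + x3 *\<^sub>R f + x4 *\<^sub>R J f) = Complex x1 x2"
    "a (x1 *\<^sub>R e + x2 *\<^sub>R J e + x3 *\<^sub>R f + x4 *\<^sub>R J f) = Complex x3 x4" for x1 x2 x3 x4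
    unfolding h_def a_def rs using dist by (auto simp: rb)
  have Jx: "J X = (- r X (J e)) *\<^sub>R e + r X e *\<^sub>R J e + (- r X (J f)) *\<^sub>R f + r X f *\<^sub>R J f" for X
  proof -
    have "J X = J (r X e *\<^sub>R e + r X (J e) *\<^sub>R J e + r X f *\<^sub>R f + r X (J f) *\<^sub>R J f)" using ex[of X] by simp
    also have "\<dots> = (- r X (J e)) *\<^sub>R e + r X e *\<^sub>R J e + (- r X (J f)) *\<^sub>R f + r X f *\<^sub>R J f"
      by (simp add: J linear_add linear_scale algebra_simps)
    finally show ?thesis .
  qed
  have hJ: "h (J X) = \<i> * h X" "a (J X) = \<i> * a X" for X
    unfolding Jx[of X] hc by (auto simp: h_def a_def complex_eq_iff)
  have "bij (\<lambda>X. (h X, a X))"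
  proof (rule bijI)
    show "inj (\<lambda>X. (h X, a X))"
    proof (rule injI)
      fix X Y assume "(h X, a X) = (h Y, a Y)"
      then have "r X e = r Y e" "r X (J e) = r Y (J e)" "r X f = r Y f" "r X (J f) = r Y (J f)"
        by (auto simp: h_def a_def)
      then show "X = Y" using ex[of X] ex[of Y] by simp
    qed
    show "surj (\<lambda>X. (h X, a X))"
    proof (rule surjI)
      fix p :: "complex \<times> complex"
      show "(h (Re (fst p) *\<^sub>R e + Im (fst p) *\<^sub>R J e + Re (snd p) *\<^sub>R f + Im (snd p) *\<^sub>R J f),
         a (Re (fst p) *\<^sub>R e + Im (fst p) *\<^sub>R J e + Re (snd p) *\<^sub>R f + Im (snd p) *\<^sub>R J f)) = p"
        by (simp add: hc complex_surj)
    qed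
  qed
  then have "coframe J h a" using hl hJ unfolding coframe_def by simp
  then show ?thesis by (rule that)
qed

definition wedge_at :: "('a \<Rightarrow> complex) \<Rightarrow> ('a \<Rightarrow> complex) \<Rightarrow> 'a \<Rightarrow> 'a \<Rightarrow> complex" where
  "wedge_at \<phi> \<psi> X Y = \<phi> X * \<psi> Y - \<phi> Y * \<psi> X"

definition cnj_form :: "('a \<Rightarrow> complex) \<Rightarrow> 'a \<Rightarrow> complex" where
  "cnj_form \<phi> X = cnj (\<phi> X)"

lemma coframe_dual:
  assumes "coframe J h a"
  obtains e f where "h e = 1" "a e = 0" "h f = 0" "a f = 1"
proof -
  have "surj (\<lambda>X. (h X, a X))" using assms by (simp add: coframe_def bij_is_surj)
  note s = surjD[OF this]
  obtain e where "(1, 0) = (h e, a e)" using s[of "(1, 0)"] by (rule exE)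
  moreover obtain f where "(0, 1) = (h f, a f)" using s[of "(0, 1)"] by (rule exE)
  ultimately show ?thesis by (intro that[of e f]) simp_all
qed

lemma coframe_expand:
  assumes cf: "coframe J h a" and ef: "h e = 1" "a e = 0" "h f = 0" "a f = 1"
  shows "X = Re (h X) *\<^sub>R e + Im (h X) *\<^sub>R J e + Re (a X) *\<^sub>R f + Im (a X) *\<^sub>R J f"
proof -
  let ?Y = "Re (h X) *\<^sub>R e + Im (h X) *\<^sub>R J e + Re (a X) *\<^sub>R f + Im (a X) *\<^sub>R J f"
  have l: "linear h" "linear a" and JJ: "\<And>X. h (J X) = \<i> * h X" "\<And>X. a (J X) = \<i> * a X"
    and i: "inj (\<lambda>X. (h X, a X))"
    using cf by (auto simp: coframe_def bij_is_inj)
  have "h ?Y = h X" "a ?Y = a X"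
    by (simp_all add: linear_add[OF l(1)] linear_add[OF l(2)] linear_scale[OF l(1)] linear_scale[OF l(2)] JJ ef complex_eq_iff)
  then show ?thesis using i by (auto dest: injD)
qed

lemma alternating_expand:
  fixes \<phi> :: "'a::real_vector \<Rightarrow> 'a \<Rightarrow> complex"
  assumes cf: "coframe J h a" and bl: "bilinear \<phi>" and alt: "\<And>X. \<phi> X X = 0"
  obtains c0 c1 c2 c3 c4 c5 where
    "\<And>X Y. \<phi> X Y = c0 * wedge_at h a X Y + c1 * wedge_at h (cnj_form h) X Y + c2 * wedge_at h (cnj_form a) X Y
       + c3 * wedge_at a (cnj_form h) X Y + c4 * wedge_at a (cnj_form a) X Y + c5 * wedge_at (cnj_form h) (cnj_form a) X Y"
proof -
  obtain e f where ef: "h e = 1" "a e = 0" "h f = 0" "a f = 1" using coframe_dual[OF cf] .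
  have sk: "\<phi> X Y = - \<phi> Y X" for X Y
  proof -
    have "\<phi> (X + Y) (X + Y) = \<phi> X Y + \<phi> Y X"
      unfolding bilinear_ladd[OF bl] bilinear_radd[OF bl] by (simp add: alt)
    then have "\<phi> X Y + \<phi> Y X = 0" by (simp add: alt)
    then show ?thesis by (simp add: eq_neg_iff_add_eq_0)
  qed
  define m1 where "m1 = \<phi> e (J e)"
  define m2 where "m2 = \<phi> e f"
  define m3 where "m3 = \<phi> e (J f)"
  define m4 where "m4 = \<phi> (J e) f"
  define m5 where "m5 = \<phi> (J e) (J f)"
  define m6 where "m6 = \<phi> f (J f)"
  have E: "\<phi> X Y = (Re (h X) * Im (h Y) - Im (h X) * Re (h Y)) *\<^sub>R m1
     + (Re (h X) * Re (a Y) - Re (a X) * Re (h Y)) *\<^sub>R m2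
     + (Re (h X) * Im (a Y) - Im (a X) * Re (h Y)) *\<^sub>R m3
     + (Im (h X) * Re (a Y) - Re (a X) * Im (h Y)) *\<^sub>R m4
     + (Im (h X) * Im (a Y) - Im (a X) * Im (h Y)) *\<^sub>R m5
     + (Re (a X) * Im (a Y) - Im (a X) * Re (a Y)) *\<^sub>R m6" for X Y
  proof -
    have "\<phi> X Y = \<phi> (Re (h X) *\<^sub>R e + Im (h X) *\<^sub>R J e + Re (a X) *\<^sub>R f + Im (a X) *\<^sub>R J f)
       (Re (h Y) *\<^sub>R e + Im (h Y) *\<^sub>R J e + Re (a Y) *\<^sub>R f + Im (a Y) *\<^sub>R J f)"
      using coframe_expand[OF cf ef, of X] coframe_expand[OF cf ef, of Y] by simp
    also have "\<dots> = (Re (h X) * Im (h Y) - Im (h X) * Re (h Y)) *\<^sub>R m1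
     + (Re (h X) * Re (a Y) - Re (a X) * Re (h Y)) *\<^sub>R m2
     + (Re (h X) * Im (a Y) - Im (a X) * Re (h Y)) *\<^sub>R m3
     + (Im (h X) * Re (a Y) - Re (a X) * Im (h Y)) *\<^sub>R m4
     + (Im (h X) * Im (a Y) - Im (a X) * Im (h Y)) *\<^sub>R m5
     + (Re (a X) * Im (a Y) - Im (a X) * Re (a Y)) *\<^sub>R m6"
      unfolding m1_def m2_def m3_def m4_def m5_def m6_def
      by (simp add: bilinear_ladd[OF bl] bilinear_radd[OF bl] bilinear_lmul[OF bl] bilinear_rmul[OF bl] alt
        sk[of "J e" e] sk[of f e] sk[of "J f" e] sk[of f "J e"] sk[of "J f" "J e"] sk[of "J f" f] algebra_simps)
    finally show ?thesis .
  qed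
  show ?thesis
  proof (rule that)
    fix X Y
    \<comment> \<open>The coefficients come from \<open>Re w = (w + cnj w) / 2\<close> and
      \<open>Im w = (w - cnj w) / (2 * \<i>)\<close>, inserted in the six real 2-forms of
      \<open>E\<close>.\<close>
    show "\<phi> X Y = ((m2 - \<i> * m3 - \<i> * m4 - m5) / 4) * wedge_at h a X Y + (\<i> * m1 / 2) * wedge_at h (cnj_form h) X Y
       + ((m2 + \<i> * m3 - \<i> * m4 + m5) / 4) * wedge_at h (cnj_form a) X Y
       + ((- m2 + \<i> * m3 - \<i> * m4 - m5) / 4) * wedge_at a (cnj_form h) X Y + (\<i> * m6 / 2) * wedge_at a (cnj_form a) X Y
       + ((m2 + \<i> * m3 + \<i> * m4 - m5) / 4) * wedge_at (cnj_form h) (cnj_form a) X Y"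
      unfolding E wedge_at_def cnj_form_def
      by (simp add: complex_eq_iff field_simps)
  qed
qed

section \<open>Structure equations\<close>

text \<open>
  The parameters are the coefficients of \<open>dh\<close> and \<open>da\<close>; the minus sign is the one in
  \<open>d\<phi>(X, Y) = - \<phi>([X, Y])\<close>. There is no \<open>(0,2)\<close>-coefficient because \<open>J\<close> is integrable.
\<close>

definition structure_eqs ::
    "('a \<Rightarrow> 'a \<Rightarrow> 'a) \<Rightarrow> ('a \<Rightarrow> complex) \<Rightarrow> ('a \<Rightarrow> complex) \<Rightarrow>
     complex \<Rightarrow> complex \<Rightarrow> complex \<Rightarrow> complex \<Rightarrow> complex \<Rightarrow>
     complex \<Rightarrow> complex \<Rightarrow> complex \<Rightarrow> complex \<Rightarrow> complex \<Rightarrow> bool" where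
  "structure_eqs br h a p A B B' C D E F G K \<longleftrightarrow>
     (\<forall>X Y. h (br X Y) = - (p * wedge_at h a X Y + A * wedge_at h (cnj_form h) X Y + B * wedge_at h (cnj_form a) X Y
        + B' * wedge_at a (cnj_form h) X Y + C * wedge_at a (cnj_form a) X Y)) \<and>
     (\<forall>X Y. a (br X Y) = - (D * wedge_at h a X Y + E * wedge_at h (cnj_form h) X Y + F * wedge_at h (cnj_form a) X Y
        + G * wedge_at a (cnj_form h) X Y + K * wedge_at a (cnj_form a) X Y))"

lemma bilinear_compose_linear:
  assumes "bilinear f" "linear g"
  shows "bilinear (\<lambda>X Y. g (f X Y))"
  unfolding bilinear_def
proof (intro conjI allI)
  show "linear (\<lambda>y. g (f x y))" for x
    using assms(1) linear_compose[OF _ assms(2), of "f x"] by (simp add: bilinear_def o_def)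
  show "linear (\<lambda>x. g (f x y))" for y
    using assms(1) linear_compose[OF _ assms(2), of "\<lambda>x. f x y"] by (simp add: bilinear_def o_def)
qed

lemma one_form_structure:
  assumes cf: "coframe J h a" and la: "lie_algebra br" and cs: "complex_structure br J"
    and \<phi>: "linear \<phi>" "\<And>X. \<phi> (J X) = \<i> * \<phi> X"
  obtains p A B B' C where
    "\<And>X Y. \<phi> (br X Y) = - (p * wedge_at h a X Y + A * wedge_at h (cnj_form h) X Y + B * wedge_at h (cnj_form a) X Y
        + B' * wedge_at a (cnj_form h) X Y + C * wedge_at a (cnj_form a) X Y)"
proof -
  have bl: "bilinear br" and alt: "br X X = 0" for X using la by (auto simp: lie_algebra_def)
  have JJ: "J (J X) = - X" for X using cs by (simp add: complex_structure_def)
  have c: "h (J X) = \<i> * h X" "a (J X) = \<i> * a X" for X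
    using cf by (auto simp: coframe_def)
  obtain c0 c1 c2 c3 c4 c5 where
    ex: "\<And>X Y. \<phi> (br X Y) = c0 * wedge_at h a X Y + c1 * wedge_at h (cnj_form h) X Y + c2 * wedge_at h (cnj_form a) X Y
       + c3 * wedge_at a (cnj_form h) X Y + c4 * wedge_at a (cnj_form a) X Y + c5 * wedge_at (cnj_form h) (cnj_form a) X Y"
  proof (rule alternating_expand[OF cf bilinear_compose_linear[OF bl \<phi>(1)]])
    show "\<phi> (br X X) = 0" for X by (simp add: alt linear_0[OF \<phi>(1)])
  qed blast
  obtain e f where ef: "h e = 1" "a e = 0" "h f = 0" "a f = 1" using coframe_dual[OF cf] .
  \<comment> \<open>In this instance of integrability the (2,0)- and (1,1)-terms cancel, which
    isolates the (0,2)-coefficient \<open>c5\<close>.\<close>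
  have "J (br e f - br (J e) (J f)) = br (J e) f + br e (J f)"
    using cs by (simp add: complex_structure_def)
  then have "\<phi> (J (br e f - br (J e) (J f))) = \<phi> (br (J e) f + br e (J f))" by simp
  then have "\<i> * (\<phi> (br e f) - \<phi> (br (J e) (J f))) = \<phi> (br (J e) f) + \<phi> (br e (J f))"
    by (simp add: \<phi>(2) linear_diff[OF \<phi>(1)] linear_add[OF \<phi>(1)])
  then have "c5 = 0"
    by (simp add: ex wedge_at_def cnj_form_def c ef JJ algebra_simps)
  then show ?thesis
    by (intro that[of "- c0" "- c1" "- c2" "- c3" "- c4"]) (simp add: ex)
qed

lemma structure_exists:
  assumes "coframe J h a" "lie_algebra br" "complex_structure br J"
  obtains p A B B' C D E F G K where "structure_eqs br h a p A B B' C D E F G K"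
proof -
  have l: "linear h" "\<And>X. h (J X) = \<i> * h X" "linear a" "\<And>X. a (J X) = \<i> * a X"
    using assms(1) by (auto simp: coframe_def)
  obtain p A B B' C where 1:
    "\<And>X Y. h (br X Y) = - (p * wedge_at h a X Y + A * wedge_at h (cnj_form h) X Y + B * wedge_at h (cnj_form a) X Y
        + B' * wedge_at a (cnj_form h) X Y + C * wedge_at a (cnj_form a) X Y)"
    by (rule one_form_structure[OF assms l(1,2)]) (rule that)
  obtain D E F G K where 2:
    "\<And>X Y. a (br X Y) = - (D * wedge_at h a X Y + E * wedge_at h (cnj_form h) X Y + F * wedge_at h (cnj_form a) X Y
        + G * wedge_at a (cnj_form h) X Y + K * wedge_at a (cnj_form a) X Y)"
    by (rule one_form_structure[OF assms l(3,4)]) (rule that)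
  show ?thesis by (rule that[of p A B B' C D E F G K]) (simp add: structure_eqs_def 1 2)
qed

section \<open>Changes of coframe: swap, shear and scaling\<close>

lemma coframe_swap:
  assumes "coframe J h a" shows "coframe J a h"
proof -
  have "(\<lambda>X. (a X, h X)) = prod.swap \<circ> (\<lambda>X. (h X, a X))" by (simp add: fun_eq_iff)
  then have "bij (\<lambda>X. (a X, h X))"
    using assms bij_comp[OF _ bij_swap] unfolding coframe_def by metis
  then show ?thesis using assms by (simp add: coframe_def)
qed

lemma structure_swap:
  assumes "structure_eqs br h a p A B B' C D E F G K"
  shows "structure_eqs br a h (- D) K G F E (- p) C B' B A"
  using assms unfolding structure_eqs_def by (simp add: wedge_at_def algebra_simps)

lemma linear_cmult:
  assumes "linear \<phi>" shows "linear (\<lambda>X. (c::complex) * \<phi> X)"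
  using assms by (auto intro!: linearI simp: linear_add linear_scale algebra_simps)

lemma coframe_shear:
  assumes "coframe J h a" shows "coframe J h (\<lambda>X. a X + u * h X)"
proof -
  have l: "linear h" "linear a" and b: "bij (\<lambda>X. (h X, a X))" using assms by (auto simp: coframe_def)
  have "bij (\<lambda>p::complex \<times> complex. (fst p, snd p + u * fst p))"
    by (rule bij_betw_byWitness[where f' = "\<lambda>p. (fst p, snd p - u * fst p)"]) auto
  from bij_comp[OF b this] have "bij (\<lambda>X. (h X, a X + u * h X))" by (simp add: o_def)
  moreover have "linear (\<lambda>X. a X + u * h X)"
    by (intro linear_compose_add l linear_cmult)
  ultimately show ?thesis using assms by (simp add: coframe_def algebra_simps)
qed

text \<open>For a' = a + u h, substitute a = a' - u h on the right-hand sides and use da' = da + u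
  dh. The product of \<open>h\<close> and \<open>a\<close> does not change, so \<open>p\<close> is
  preserved.\<close>

lemma structure_shear:
  assumes "structure_eqs br h a p A B B' C D E F G K"
  shows "structure_eqs br h (\<lambda>X. a X + u * h X) p
    (A - B * cnj u - B' * u + C * u * cnj u) (B - C * u) (B' - C * cnj u) C
    (D + u * p)
    (E - F * cnj u - G * u + K * u * cnj u + u * (A - B * cnj u - B' * u + C * u * cnj u))
    (F - K * u + u * (B - C * u)) (G - K * cnj u + u * (B' - C * cnj u)) (K + u * C)"
proof -
  note s = assms[unfolded structure_eqs_def, THEN conjunct1, rule_format]
     assms[unfolded structure_eqs_def, THEN conjunct2, rule_format]
  show ?thesis
    unfolding structure_eqs_def by (simp add: s wedge_at_def cnj_form_def algebra_simps)
qed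

lemma coframe_scale:
  assumes "coframe J h a" "l \<noteq> 0" shows "coframe J (\<lambda>X. l * h X) a"
proof -
  have l: "linear h" and b: "bij (\<lambda>X. (h X, a X))" using assms by (auto simp: coframe_def)
  have "bij (\<lambda>p::complex \<times> complex. (l * fst p, snd p))"
    by (rule bij_betw_byWitness[where f' = "\<lambda>p. (fst p / l, snd p)"]) (auto simp: assms)
  from bij_comp[OF b this] have "bij (\<lambda>X. (l * h X, a X))" by (simp add: o_def)
  then show ?thesis using assms linear_cmult[OF l] by (simp add: coframe_def algebra_simps)
qed

lemma structure_scale:
  assumes "structure_eqs br h a p A B B' C D E F G K" "l \<noteq> 0"
  shows "structure_eqs br (\<lambda>X. l * h X) a p (A / cnj l) B (l * B' / cnj l) (l * C)
     (D / l) (E / (l * cnj l)) (F / l) (G / cnj l) K"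
proof -
  note s = assms(1)[unfolded structure_eqs_def, THEN conjunct1, rule_format]
     assms(1)[unfolded structure_eqs_def, THEN conjunct2, rule_format]
  show ?thesis
    unfolding structure_eqs_def using assms(2) by (simp add: s wedge_at_def cnj_form_def field_simps)
qed

section \<open>The Jacobi identity as d(dh) = 0 and d(da) = 0\<close>

lemma jacobi_first:
  assumes cf: "coframe J h a" and la: "lie_algebra br" and se: "structure_eqs br h a 0 A B B' C D E F G K"
  shows
    "A * cnj B + B * cnj F + B' * (D - cnj A) - C * cnj E = 0"
    "- B * cnj D - B' * F + C * E = 0"
    "A * cnj C + B * cnj K - B' * cnj B' + C * (D - cnj G) = 0"
    "- A * C + B * B' - B' * K + C * (G - cnj D) = 0"
proof -
  obtain e f where ef: "h e = 1" "a e = 0" "h f = 0" "a f = 1" using coframe_dual[OF cf] .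
  have c: "h (J X) = \<i> * h X" "a (J X) = \<i> * a X" for X
    using cf by (auto simp: coframe_def)
  have lin: "linear h" using cf by (auto simp: coframe_def)
  have jac: "h (br X (br Y Z)) + h (br Y (br Z X)) + h (br Z (br X Y)) = 0" for X Y Z
    using la by (simp add: lie_algebra_def linear_0[OF lin] flip: linear_add[OF lin])
  note s = se[unfolded structure_eqs_def wedge_at_def cnj_form_def, THEN conjunct1, rule_format]
     se[unfolded structure_eqs_def wedge_at_def cnj_form_def, THEN conjunct2, rule_format]
  \<comment> \<open>\<open>P\<close>, \<open>R\<close>, \<open>Q\<close>, \<open>S\<close> are the
    coefficients of d(dh) at h \<and> a \<and> cnj h, h \<and> cnj h \<and> cnj a, h \<and> a \<and>
    cnj a and a \<and> cnj h \<and> cnj a. A triple of real vectors sees a (2,1)- and a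
    (1,2)-coefficient at once; applying \<open>J\<close> to its last vector separates them.\<close>
  define P where "P = A * cnj B + B * cnj F + B' * (D - cnj A) - C * cnj E"
  define R where "R = - B * cnj D - B' * F + C * E"
  define Q where "Q = A * cnj C + B * cnj K - B' * cnj B' + C * (D - cnj G)"
  define S where "S = - A * C + B * B' - B' * K + C * (G - cnj D)"
  have "2 * \<i> * (P - R) = 0"
    using jac[of e "J e" f] by (simp add: s ef c P_def R_def algebra_simps)
  then have 1: "P - R = 0" by simp
  have "2 * (P + R) = 0"
    using jac[of e "J e" "J f"] by (simp add: s ef c P_def R_def algebra_simps)
  then have 2: "P + R = 0" by (simp del: distrib_left_numeral)
  have "2 * \<i> * (Q - S) = 0"
    using jac[of f "J f" e] by (simp add: s ef c Q_def S_def algebra_simps)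
  then have 3: "Q - S = 0" by simp
  have "2 * (Q + S) = 0"
    using jac[of f "J f" "J e"] by (simp add: s ef c Q_def S_def algebra_simps)
  then have 4: "Q + S = 0" by (simp del: distrib_left_numeral)
  have "P = 0" "R = 0" "Q = 0" "S = 0" using 1 2 3 4 by auto
  then show "A * cnj B + B * cnj F + B' * (D - cnj A) - C * cnj E = 0"
    "- B * cnj D - B' * F + C * E = 0"
    "A * cnj C + B * cnj K - B' * cnj B' + C * (D - cnj G) = 0"
    "- A * C + B * B' - B' * K + C * (G - cnj D) = 0"
    unfolding P_def R_def Q_def S_def by - assumption+
qed

text \<open>The same four coefficients, now of d(da).\<close>

lemma jacobi_second:
  assumes cf: "coframe J h a" and la: "lie_algebra br" and se: "structure_eqs br h a 0 A B B' C D E F G K"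
  shows
    "- D * A - G * cnj A + E * cnj B + F * cnj F - K * cnj E = 0"
    "- E * B + F * (A - cnj D) - G * F + K * E = 0"
    "- D * B + E * cnj C + F * cnj K - G * cnj B' - K * cnj G = 0"
    "- E * C + F * B' - K * cnj D = 0"
proof -
  obtain e f where ef: "h e = 1" "a e = 0" "h f = 0" "a f = 1" using coframe_dual[OF cf] .
  have c: "h (J X) = \<i> * h X" "a (J X) = \<i> * a X" for X
    using cf by (auto simp: coframe_def)
  have lin: "linear a" using cf by (auto simp: coframe_def)
  have jac: "a (br X (br Y Z)) + a (br Y (br Z X)) + a (br Z (br X Y)) = 0" for X Y Z
    using la by (simp add: lie_algebra_def linear_0[OF lin] flip: linear_add[OF lin])
  note s = se[unfolded structure_eqs_def wedge_at_def cnj_form_def, THEN conjunct1, rule_format]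
     se[unfolded structure_eqs_def wedge_at_def cnj_form_def, THEN conjunct2, rule_format]
  define P where "P = - D * A - G * cnj A + E * cnj B + F * cnj F - K * cnj E"
  define R where "R = - E * B + F * (A - cnj D) - G * F + K * E"
  define Q where "Q = - D * B + E * cnj C + F * cnj K - G * cnj B' - K * cnj G"
  define S where "S = - E * C + F * B' - K * cnj D"
  have "2 * \<i> * (P - R) = 0"
    using jac[of e "J e" f] by (simp add: s ef c P_def R_def algebra_simps)
  then have 1: "P - R = 0" by simp
  have "2 * (P + R) = 0"
    using jac[of e "J e" "J f"] by (simp add: s ef c P_def R_def algebra_simps)
  then have 2: "P + R = 0" by (simp del: distrib_left_numeral)
  have "2 * \<i> * (Q - S) = 0"
    using jac[of f "J f" e] by (simp add: s ef c Q_def S_def algebra_simps)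
  then have 3: "Q - S = 0" by simp
  have "2 * (Q + S) = 0"
    using jac[of f "J f" "J e"] by (simp add: s ef c Q_def S_def algebra_simps)
  then have 4: "Q + S = 0" by (simp del: distrib_left_numeral)
  have "P = 0" "R = 0" "Q = 0" "S = 0" using 1 2 3 4 by auto
  then show "- D * A - G * cnj A + E * cnj B + F * cnj F - K * cnj E = 0"
    "- E * B + F * (A - cnj D) - G * F + K * E = 0"
    "- D * B + E * cnj C + F * cnj K - G * cnj B' - K * cnj G = 0"
    "- E * C + F * B' - K * cnj D = 0"
    unfolding P_def R_def Q_def S_def by - assumption+
qed


section \<open>Real and taming 2-forms in a coframe\<close>

lemma real_alternating_expand:
  fixes r :: "'a::real_vector \<Rightarrow> 'a \<Rightarrow> real"
  assumes cf: "coframe J h a" and bl: "bilinear r" and alt: "\<And>X. r X X = 0"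
  obtains x y :: real and z c where "\<And>X Y. complex_of_real (r X Y) = c * wedge_at h a X Y
       + \<i> * x * wedge_at h (cnj_form h) X Y + z * wedge_at h (cnj_form a) X Y - cnj z * wedge_at a (cnj_form h) X Y
       + \<i> * y * wedge_at a (cnj_form a) X Y + cnj c * wedge_at (cnj_form h) (cnj_form a) X Y"
proof -
  obtain e f where ef: "h e = 1" "a e = 0" "h f = 0" "a f = 1" using coframe_dual[OF cf] .
  have c: "h (J X) = \<i> * h X" "a (J X) = \<i> * a X" for X
    using cf by (auto simp: coframe_def)
  have blc: "bilinear (\<lambda>X Y. complex_of_real (r X Y))"
    by (rule bilinear_compose_linear[OF bl]) (auto intro!: linearI simp: scaleR_conv_of_real)
  obtain c0 c1 c2 c3 c4 c5 where ex: "\<And>X Y. complex_of_real (r X Y) =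
       c0 * wedge_at h a X Y + c1 * wedge_at h (cnj_form h) X Y + c2 * wedge_at h (cnj_form a) X Y
       + c3 * wedge_at a (cnj_form h) X Y + c4 * wedge_at a (cnj_form a) X Y + c5 * wedge_at (cnj_form h) (cnj_form a) X Y"
    by (rule alternating_expand[OF cf blc]) (simp add: alt, rule that)
  note ex' = ex[unfolded wedge_at_def cnj_form_def]
  have c1: "c1 = \<i> * (r e (J e) / 2)"
    using ex'[of e "J e"] by (auto simp: ef c complex_eq_iff)
  have c4: "c4 = \<i> * (r f (J f) / 2)"
    using ex'[of f "J f"] by (auto simp: ef c complex_eq_iff)
  have "complex_of_real (r e f) = c0 + c2 - c3 + c5"
    "complex_of_real (r e (J f)) = \<i> * (c0 - c2 - c3 - c5)"
    "complex_of_real (r (J e) f) = \<i> * (c0 + c2 + c3 - c5)"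
    "complex_of_real (r (J e) (J f)) = - c0 + c2 - c3 - c5"
    using ex'[of e f] ex'[of e "J f"] ex'[of "J e" f] ex'[of "J e" "J f"]
    by (simp_all add: ef c algebra_simps)
  then have c35: "c3 = - cnj c2" "c5 = cnj c0"
    unfolding complex_eq_iff by auto
  show ?thesis
    by (rule that[of c0 "r e (J e) / 2" c2 "r f (J f) / 2"], subst ex) (simp add: c1 c4 c35)
qed

text \<open>The inequalities express positivity of the (1,1)-part of \<open>\<Omega>\<close>, and
  \<open>c\<close> is its (2,0)-coefficient. The equation is the coefficient of h \<and> a \<and>
  cnj a in the differential of \<open>\<Omega>\<close>.\<close>

lemma taming_coframe:
  assumes cf: "coframe J h a" and se: "structure_eqs br h a 0 A B B' C D E F G K"
    and ta: "taming_symplectic_form br J \<Omega>"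
  obtains x y :: real and z c where "x > 0" "y > 0" "(cmod z)\<^sup>2 < x * y"
    "\<i> * x * cnj C + \<i> * y * (D - cnj G) + z * cnj K + cnj z * cnj B' - c * (B + K) = 0"
proof -
  obtain e f where ef: "h e = 1" "a e = 0" "h f = 0" "a f = 1" using coframe_dual[OF cf] .
  have c: "h (J X) = \<i> * h X" "a (J X) = \<i> * a X" for X
    using cf by (auto simp: coframe_def)
  have lin: "linear h" "linear a" using cf by (auto simp: coframe_def)
  have fm: "form 2 \<Omega>" and cl: "ce_diff br \<Omega> [X, Y, Z] = 0" and pos: "X \<noteq> 0 \<Longrightarrow> \<Omega> [X, J X] > 0" for X Y Z
    using ta by (auto simp: taming_symplectic_form_def)
  define \<phi> where "\<phi> X Y = complex_of_real (\<Omega> [X, Y])" for X Y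
  have l1: "linear (\<lambda>X. \<Omega> [X, Y])" for Y
    using fm[unfolded form_def, THEN conjunct2, THEN conjunct1, rule_format, of "[Y, Y]" 0] by simp
  have l2: "linear (\<lambda>Y. \<Omega> [X, Y])" for X
    using fm[unfolded form_def, THEN conjunct2, THEN conjunct1, rule_format, of "[X, X]" 1] by simp
  have bl: "bilinear (\<lambda>X Y. \<Omega> [X, Y])"
    unfolding bilinear_def using l1 l2 by blast
  have alt: "\<Omega> [X, X] = 0" for X
    using fm[unfolded form_def, THEN conjunct2, THEN conjunct2, rule_format, of "[X, X]" 0 1] by simp
  obtain x y :: real and z c0 where ex0: "\<And>X Y. complex_of_real (\<Omega> [X, Y]) = c0 * wedge_at h a X Y + \<i> * x * wedge_at h (cnj_form h) X Y
       + z * wedge_at h (cnj_form a) X Y - cnj z * wedge_at a (cnj_form h) X Y + \<i> * y * wedge_at a (cnj_form a) X Y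
       + cnj c0 * wedge_at (cnj_form h) (cnj_form a) X Y"
    by (rule real_alternating_expand[OF cf bl alt]) (rule that)
  note ex2 = ex0[folded \<phi>_def]
  note ex3 = ex2[unfolded wedge_at_def cnj_form_def]
  have ne: "e \<noteq> 0" "f \<noteq> 0" using ef linear_0[OF lin(1)] linear_0[OF lin(2)] by auto
  have "\<Omega> [e, J e] = 2 * x" "\<Omega> [f, J f] = 2 * y"
    using ex3[of e "J e"] ex3[of f "J f"] by (auto simp: ef c \<phi>_def complex_eq_iff)
  then have xy: "x > 0" "y > 0" using pos[of e] pos[of f] ne by auto
  have zz: "(cmod z)\<^sup>2 < x * y"
  proof -
    have "surj (\<lambda>X. (h X, a X))" using cf by (simp add: coframe_def bij_is_surj)
    \<comment> \<open>Among the vectors with \<open>h V = y\<close> this one minimises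
      \<open>\<Omega> [V, J V]\<close>; the minimum is \<open>2 * y\<close> times the determinant
      \<open>x * y - (cmod z)\<^sup>2\<close>.\<close>
    from surjD[OF this, of "(of_real y, \<i> * z)"] obtain V where V: "h V = of_real y" "a V = \<i> * z" by auto
    have "V \<noteq> 0" using V(1) xy linear_0[OF lin(1)] by auto
    then have p: "\<Omega> [V, J V] > 0" by (rule pos)
    have "complex_of_real (\<Omega> [V, J V]) = of_real (2 * y * (x * y)) - of_real (2 * y) * (z * cnj z)"
      using ex2[of V "J V"] by (simp add: \<phi>_def wedge_at_def cnj_form_def c V algebra_simps power2_eq_square)
    also have "\<dots> = of_real (2 * y * (x * y - (cmod z)\<^sup>2))"
      by (simp add: complex_norm_square[symmetric] algebra_simps)
    finally have "\<Omega> [V, J V] = 2 * y * (x * y - (cmod z)\<^sup>2)" using of_real_eq_iff by blast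
    then show ?thesis using p xy by (simp add: zero_less_mult_iff)
  qed
  have closed: "\<phi> (br X Y) Z - \<phi> (br X Z) Y + \<phi> (br Y Z) X = 0" for X Y Z
  proof -
    have "ce_diff br \<Omega> [X, Y, Z] = - \<Omega> [br X Y, Z] + \<Omega> [br X Z, Y] - \<Omega> [br Y Z, X]"
      by (simp add: ce_diff_def eval_nat_numeral lessThan_Suc greaterThanLessThan_def nths_Cons)
    then have "\<Omega> [br X Y, Z] - \<Omega> [br X Z, Y] + \<Omega> [br Y Z, X] = 0" using cl[of X Y Z] by simp
    then show ?thesis unfolding \<phi>_def by (metis of_real_0 of_real_add of_real_diff)
  qed
  note s = se[unfolded structure_eqs_def wedge_at_def cnj_form_def, THEN conjunct1, rule_format]
     se[unfolded structure_eqs_def wedge_at_def cnj_form_def, THEN conjunct2, rule_format]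
  \<comment> \<open>\<open>Q\<close> is the coefficient of h \<and> a \<and> cnj a in the
    differential of \<open>\<Omega>\<close>, and \<open>T\<close> is minus that of a \<and> cnj h
    \<and> cnj a. The two evaluations separate them.\<close>
  define Q where "Q = \<i> * x * cnj C + \<i> * y * (D - cnj G) + z * cnj K + cnj z * cnj B' - c0 * (B + K)"
  define T where "T = cnj c0 * (cnj B + cnj K) + \<i> * x * C + \<i> * y * (cnj D - G) - B' * z - K * cnj z"
  have "2 * (Q - T) = 0"
    using closed[of f "J f" "J e"] by (simp add: s ex3 ef c Q_def T_def algebra_simps)
  moreover have "2 * \<i> * (Q + T) = 0"
    using closed[of f "J f" e] by (simp add: s ex3 ef c Q_def T_def algebra_simps)
  ultimately have "Q = 0" by auto
  then show ?thesis using that[OF xy zz] unfolding Q_def by blast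
qed

text \<open>
  The first equation says that the \<open>(1,1)\<close>-form with coefficients \<open>A, B, B', C\<close> is orthogonal to a
  positive one, the second that its Hermitian square vanishes.
\<close>

lemma unimodular_closed:
  fixes x y :: real
  assumes "x > 0" "y > 0" "(cmod z)\<^sup>2 < x * y"
    and 1: "\<i> * x * cnj C + \<i> * y * cnj A - z * cnj B + cnj z * cnj B' = 0"
    and 2: "A * cnj C + C * cnj A = B * cnj B + B' * cnj B'"
  shows "A = 0 \<and> B = 0 \<and> B' = 0 \<and> C = 0"
proof -
  let ?b = "cmod B" and ?b' = "cmod B'" and ?s = "cmod A" and ?t = "cmod C" and ?m = "cmod z"
  have "2 * Re (A * cnj C) = ?b\<^sup>2 + ?b'\<^sup>2"
    using arg_cong[OF 2, of Re] unfolding cmod_power2 by (simp add: power2_eq_square algebra_simps)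
  have "\<i> * (x * cnj C + y * cnj A) = z * cnj B - cnj z * cnj B'"
    using 1 by (simp add: algebra_simps eq_neg_iff_add_eq_0)
  then have "cmod (x * cnj C + y * cnj A) = cmod (z * cnj B - cnj z * cnj B')"
    by (metis mult_1 norm_ii norm_mult)
  also have "\<dots> \<le> ?m * (?b + ?b')"
    using norm_triangle_ineq4[of "z * cnj B" "cnj z * cnj B'"] by (simp add: norm_mult algebra_simps)
  finally have m1: "(cmod (x * cnj C + y * cnj A))\<^sup>2 \<le> (?m * (?b + ?b'))\<^sup>2"
    by (intro power_mono) auto
  have m2: "(cmod (x * cnj C + y * cnj A))\<^sup>2 = (x * ?t)\<^sup>2 + (y * ?s)\<^sup>2 + x * y * (2 * Re (A * cnj C))"
    unfolding power_mult_distrib cmod_power2 by (simp add: power2_eq_square algebra_simps)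
  have m3: "(?m * (?b + ?b'))\<^sup>2 \<le> 2 * ?m\<^sup>2 * (?b\<^sup>2 + ?b'\<^sup>2)"
  proof -
    have "(?b + ?b')\<^sup>2 \<le> 2 * (?b\<^sup>2 + ?b'\<^sup>2)"
      using zero_le_power2[of "?b - ?b'"] by (simp add: power2_eq_square algebra_simps)
    then have "?m\<^sup>2 * (?b + ?b')\<^sup>2 \<le> ?m\<^sup>2 * (2 * (?b\<^sup>2 + ?b'\<^sup>2))"
      by (rule mult_left_mono) simp
    then show ?thesis by (simp only: power_mult_distrib mult_ac)
  qed
  have I: "(x * ?t)\<^sup>2 + (y * ?s)\<^sup>2 + x * y * (?b\<^sup>2 + ?b'\<^sup>2) \<le> 2 * ?m\<^sup>2 * (?b\<^sup>2 + ?b'\<^sup>2)"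
    using m1 m2 m3 unfolding \<open>2 * Re (A * cnj C) = ?b\<^sup>2 + ?b'\<^sup>2\<close> by linarith
  have "?b\<^sup>2 + ?b'\<^sup>2 \<le> 2 * (?s * ?t)"
    \<comment> \<open>With the inequality of arithmetic and geometric means, this bounds
      \<open>x * y * (?b\<^sup>2 + ?b'\<^sup>2)\<close> by the first two terms of \<open>I\<close>.
      So \<open>I\<close> contradicts \<open>?m\<^sup>2 < x * y\<close> unless \<open>B\<close> and
      \<open>B'\<close> vanish.\<close>
    using complex_Re_le_cmod[of "A * cnj C"] \<open>2 * Re (A * cnj C) = ?b\<^sup>2 + ?b'\<^sup>2\<close> by (simp add: norm_mult)
  then have "x * y * (?b\<^sup>2 + ?b'\<^sup>2) \<le> x * y * (2 * (?s * ?t))"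
    using assms(1,2) by (intro mult_left_mono) auto
  also have "\<dots> \<le> (x * ?t)\<^sup>2 + (y * ?s)\<^sup>2"
    using zero_le_power2[of "x * ?t - y * ?s"] by (simp add: power2_eq_square algebra_simps)
  finally have "(x * y - ?m\<^sup>2) * (?b\<^sup>2 + ?b'\<^sup>2) \<le> 0" using I by (simp add: algebra_simps)
  then have "?b\<^sup>2 + ?b'\<^sup>2 \<le> 0" using assms(3) by (simp add: mult_le_0_iff)
  then have b: "?b\<^sup>2 + ?b'\<^sup>2 = 0" by (meson antisym sum_power2_ge_zero)
  then have "B = 0" "B' = 0" by (simp_all add: sum_power2_eq_zero_iff)
  have "(x * ?t)\<^sup>2 + (y * ?s)\<^sup>2 \<le> 0" using I b by simp
  then have "(x * ?t)\<^sup>2 = 0 \<and> (y * ?s)\<^sup>2 = 0" by (metis add_nonneg_eq_0_iff antisym sum_power2_ge_zero zero_le_power2)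
  then show ?thesis using \<open>B = 0\<close> \<open>B' = 0\<close> assms(1,2) by simp
qed

section \<open>Normal form in the presence of a taming form\<close>

text \<open>The (2,0)-forms are one-dimensional, so some non-zero (1,0)-form is killed by the
  (2,0)-part of d. If \<open>h\<close> is not, the shear with \<open>u = - D / p\<close> makes
  \<open>a\<close> such a form, and the swap puts it first.\<close>

lemma coframe_without_20:
  assumes "lie_algebra br" "dim (UNIV :: 'a::real_vector set) = 4" "complex_structure br (J :: 'a \<Rightarrow> 'a)"
  obtains h a A B B' C D E F G K where
    "coframe J h a" "structure_eqs br h a 0 A B B' C D E F G K"
proof -
  have J: "linear J" "\<And>X. J (J X) = - X" using assms(3) by (auto simp: complex_structure_def)
  obtain h a where cf: "coframe J h a" by (rule coframe_exists[OF J assms(2)])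
  obtain p A B B' C D E F G K where se: "structure_eqs br h a p A B B' C D E F G K"
    by (rule structure_exists[OF cf assms(1,3)])
  show ?thesis
  proof (cases "p = 0")
    case True
    then show ?thesis using that cf se by blast
  next
    case False
    from structure_swap[OF structure_shear[OF se, of "- D / p"]] coframe_swap[OF coframe_shear[OF cf, of "- D / p"]] False
    show ?thesis by (intro that) auto
  qed
qed

text \<open>Vanishing of the trace form removes the unknown \<open>c\<close> from the taming
  equation. This equation and the third identity of \<open>jacobi_first\<close> then become the
  hypotheses of \<open>unimodular_closed\<close>.\<close>

lemma unimodular_vanish:
  assumes cf: "coframe J h a" and la: "lie_algebra br" and se: "structure_eqs br h a 0 A B B' C D E F G K"
    and ta: "taming_symplectic_form br J \<Omega>"
    and t1: "cnj A + cnj G - D = 0" and t2: "B + K = 0"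
  shows "A = 0 \<and> B = 0 \<and> B' = 0 \<and> C = 0"
proof -
  obtain x y :: real and z c where xyz: "x > 0" "y > 0" "(cmod z)\<^sup>2 < x * y" and
    1: "\<i> * x * cnj C + \<i> * y * (D - cnj G) + z * cnj K + cnj z * cnj B' - c * (B + K) = 0"
    by (rule taming_coframe[OF cf se ta])
  have D: "D - cnj G = cnj A" using t1 by (simp add: algebra_simps)
  have K: "K = - B" using t2 by (simp add: eq_neg_iff_add_eq_0 add.commute)
  have "\<i> * x * cnj C + \<i> * y * cnj A - z * cnj B + cnj z * cnj B' = 0"
    using 1 unfolding D K by simp
  moreover have "A * cnj C + C * cnj A = B * cnj B + B' * cnj B'"
    using jacobi_first(3)[OF cf la se] unfolding D K by (simp add: algebra_simps)
  ultimately show ?thesis by (rule unimodular_closed[OF xyz])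
qed

text \<open>\<open>N\<close> is the determinant of the real-linear map taking \<open>u\<close> to
  \<open>p * u - F * cnj u\<close>; the solution comes from the equation and its conjugate by
  Cramer's rule.\<close>

lemma solve_antilinear:
  fixes E p F :: complex
  assumes "cmod F \<noteq> cmod p"
  obtains u where "E + p * u - F * cnj u = 0"
proof -
  define N where "N = p * cnj p - F * cnj F"
  have N: "N = of_real ((cmod p)\<^sup>2 - (cmod F)\<^sup>2)" by (simp add: N_def complex_norm_square del: of_real_power)
  have "(cmod p)\<^sup>2 \<noteq> (cmod F)\<^sup>2" using assms by simp
  then have N0: "N \<noteq> 0" unfolding N by (metis eq_iff_diff_eq_0 of_real_eq_0_iff)
  have cN: "cnj N = N" by (simp add: N)
  define u where "u = - (cnj p * E + F * cnj E) / N"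
  have "N * (E + p * u - F * cnj u) = 0"
    unfolding u_def using N0 by (simp add: cN field_simps) (simp add: N_def algebra_simps)
  then show ?thesis using N0 that[of u] by simp
qed

text \<open>
  The third conjunct is the closedness of \<open>\<i> (x h \<and> cnj h + y a \<and> cnj a)\<close>. In the last one,
  \<open>- (A + G)\<close> is the coefficient of \<open>d(h \<and> a)\<close>, and \<open>A + cnj G - D\<close> that of \<open>h\<close> in the trace form.
\<close>

definition normal_frame ::
    "('a::real_vector \<Rightarrow> 'a \<Rightarrow> 'a) \<Rightarrow> ('a \<Rightarrow> 'a) \<Rightarrow> ('a \<Rightarrow> complex) \<Rightarrow> ('a \<Rightarrow> complex) \<Rightarrow>
     real \<Rightarrow> real \<Rightarrow> complex \<Rightarrow> complex \<Rightarrow> complex \<Rightarrow> bool" where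
  "normal_frame br J h a A C D F G \<longleftrightarrow>
    coframe J h a \<and> structure_eqs br h a 0 (complex_of_real A) 0 0 (complex_of_real C) D 0 F G 0 \<and>
    (\<exists>(x::real) (y::real). x > 0 \<and> y > 0 \<and> x * C + y * (D - cnj G) = 0) \<and>
    (A = 0 \<and> C = 0 \<and> D = 0 \<and> F = 0 \<and> G = 0 \<or>
     A + G \<noteq> 0 \<and> (C = 0 \<and> D = cnj G \<or> A + cnj G - D \<noteq> 0))"

lemma normal_frame_unimodular:
  assumes cf: "coframe J h a" and la: "lie_algebra br" and se: "structure_eqs br h a 0 A B B' C D E F G K"
    and ta: "taming_symplectic_form br J \<Omega>"
    and t1: "cnj A + cnj G - D = 0" and t2: "B + K = 0"
  shows "\<exists>h a A C D F G. normal_frame br J h a A C D F G"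
proof -
  have 0: "A = 0" "B = 0" "B' = 0" "C = 0" "K = 0"
    using unimodular_vanish[OF cf la se ta t1 t2] t2 by auto
  show ?thesis
  proof (cases "D = 0")
    case True
    then have G: "G = 0" using t1 0 by simp
    have "structure_eqs br a h 0 K G F E 0 C B' B A" using structure_swap[OF se] True by simp
    \<comment> \<open>Since \<open>D = 0\<close>, the differential of \<open>a\<close> has no
      (2,0)-part either, so the argument for \<open>h\<close> applies to \<open>a\<close> as well:
      the algebra is abelian.\<close>
    from unimodular_vanish[OF coframe_swap[OF cf] la this ta] have "E = 0" "F = 0"
      using 0 G by auto
    then have "normal_frame br J h a 0 0 0 0 0"
      unfolding normal_frame_def using cf se 0 G True by (auto simp: gt_ex)
    then show ?thesis by blast
  next
    case False
    have G: "D = cnj G" using t1 0 by simp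
    then have "G \<noteq> 0" using False by auto
    \<comment> \<open>The identity reduces to \<open>F * cnj F = 0\<close>. What is left to remove
      is \<open>E\<close>, by a shear with \<open>E / G\<close>.\<close>
    have "F = 0" using jacobi_second(1)[OF cf la se] 0 by simp
    have "normal_frame br J h (\<lambda>X. a X + E / G * h X) 0 0 D 0 G"
      unfolding normal_frame_def
      using coframe_shear[OF cf, of "E / G"] structure_shear[OF se, of "E / G"] 0 G \<open>G \<noteq> 0\<close> \<open>F = 0\<close>
      by (auto intro!: exI[of _ "1::real"])
    then show ?thesis by blast
  qed
qed

text \<open>
  \<open>cnj A + cnj G - D\<close> and \<open>cnj (B + K)\<close> are the coefficients of \<open>h\<close> and \<open>a\<close> in the trace form, so
  \<open>h\<close> becomes its \<open>(1,0)\<close>-part when they are \<open>1\<close> and \<open>0\<close>.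
\<close>

lemma trace_frame:
  assumes cf: "coframe J h a" and la: "lie_algebra br" and se: "structure_eqs br h a 0 A B B' C D E F G K"
    and nt: "\<not> (cnj A + cnj G - D = 0 \<and> B + K = 0)"
  obtains h a A B B' C D E F G K where
    "coframe J h a" "structure_eqs br h a 0 A B B' C D E F G K" "cnj A + cnj G - D = 1" "B + K = 0"
proof -
  note conclusion = that
  \<comment> \<open>Multiplying \<open>h\<close> by its own coefficient in the trace form normalises
    that coefficient to 1.\<close>
  have goal: thesis if cf: "coframe J h a" and se: "structure_eqs br h a 0 A B B' C D E F G K"
    and t: "cnj A + cnj G - D \<noteq> 0" "B + K = 0" for h a A B B' C D E F G K
  proof (rule conclusion)
    show "coframe J (\<lambda>X. (cnj A + cnj G - D) * h X) a" by (rule coframe_scale[OF cf t(1)])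
  next
    show "cnj (A / cnj (cnj A + cnj G - D)) + cnj (G / cnj (cnj A + cnj G - D)) - D / (cnj A + cnj G - D) = 1"
      using t(1) by (simp add: diff_divide_distrib[symmetric] add_divide_distrib[symmetric])
  qed (rule structure_scale[OF se t(1)], fact)
  show ?thesis
  proof (cases "B + K = 0")
    case True
    then show ?thesis using goal[OF cf se] nt by blast
  next
    case False
    \<comment> \<open>This is the conjugate of the (2,0)-coefficient in the differential of the
      trace form.\<close>
    have "cnj D * (B + K) = - ((- B * cnj D - B' * F + C * E) + (- E * C + F * B' - K * cnj D))"
      by (simp add: algebra_simps)
    also have "\<dots> = 0"
      by (simp only: jacobi_first(2)[OF cf la se] jacobi_second(4)[OF cf la se] add_0 minus_zero)
    finally have "cnj D * (B + K) = 0" .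
    then have D: "D = 0" using False by simp
    \<comment> \<open>As \<open>D = 0\<close>, the (1,0)-part of the trace form is
      \<open>cnj B + cnj K\<close> times a + u h. The shear produces this form, and the swap makes
      it the first one.\<close>
    define u where "u = (cnj A + cnj G) / (cnj B + cnj K)"
    have nz: "cnj B + cnj K \<noteq> 0" using False by (metis complex_cnj_add complex_cnj_zero_iff)
    have u: "cnj u * (B + K) = A + G" using False by (simp add: u_def)
    note S = structure_swap[OF structure_shear[OF se, of u], unfolded D mult_zero_right add_0_right minus_zero]
    show ?thesis
    proof (rule goal[OF coframe_swap[OF coframe_shear[OF cf]] S])
      have "cnj (K + u * C) + cnj (B - C * u) - 0 = cnj B + cnj K" by simp
      then show "cnj (K + u * C) + cnj (B - C * u) - 0 \<noteq> 0" using nz by (simp only: not_False_eq_True)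
      show "G - K * cnj u + u * (B' - C * cnj u) + (A - B * cnj u - B' * u + C * u * cnj u) = 0"
        using u by (simp add: algebra_simps)
    qed
  qed
qed

text \<open>The first three conclusions say that the trace form h + cnj h is closed. The Jacobi
  identity equates \<open>A\<close> and \<open>C\<close> with self-conjugate expressions, and
  \<open>B'\<close> and \<open>cnj B\<close> with one and the same expression up to the factors
  shown to agree. The fourth is then the coefficient of h \<and> a \<and> cnj a in d(dh) =
  0.\<close>

lemma trace_frame_real:
  assumes cf: "coframe J h a" and la: "lie_algebra br" and se: "structure_eqs br h a 0 A B B' C D E F G K"
    and t: "cnj A + cnj G - D = 1" "B + K = 0"
  shows "cnj A = A" "B' = cnj B" "cnj C = C" "C * (2 * A - 1) = 2 * (B * cnj B)"
proof -
  have D: "D = cnj G + cnj A - 1" using t(1) by (simp add: algebra_simps)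
  have K: "K = - B" using t(2) by (simp add: eq_neg_iff_add_eq_0 add.commute)
  define S where "S = cnj G * A + G * cnj A + A * cnj A - (E * cnj B + B * cnj E) - F * cnj F"
  have "A = S"
    using jacobi_second(1)[OF cf la se] unfolding D K S_def by (simp add: algebra_simps)
  moreover have "cnj S = S" by (simp add: S_def algebra_simps)
  ultimately show A: "cnj A = A" by simp
  have 1: "B' = A * cnj B + B * cnj F + B' * cnj G - C * cnj E"
    using jacobi_first(1)[OF cf la se] unfolding D K by (simp add: algebra_simps)
  have 2: "B = cnj A * B - E * cnj C + F * cnj B + G * cnj B'"
    using jacobi_second(3)[OF cf la se] unfolding D K by (simp add: algebra_simps)
  show B: "B' = cnj B"
    using 1 arg_cong[OF 2, of cnj] by (simp add: algebra_simps) (metis add_right_cancel)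
  define T where "T = A * cnj C + C * cnj A - B * cnj B - B' * cnj B'"
  have 3: "C = T"
    using jacobi_first(3)[OF cf la se] unfolding D K T_def by (simp add: algebra_simps)
  moreover have "cnj T = T" by (simp add: T_def algebra_simps)
  ultimately show C: "cnj C = C" by simp
  show "C * (2 * A - 1) = 2 * (B * cnj B)" using 3 unfolding T_def by (simp add: A B C algebra_simps)
qed

lemma normal_frame_nonunimodular:
  assumes cf: "coframe J h a" and la: "lie_algebra br" and se: "structure_eqs br h a 0 A B B' C D E F G K"
    and ta: "taming_symplectic_form br J \<Omega>"
    and t: "cnj A + cnj G - D = 1" "B + K = 0"
  shows "\<exists>h a A C D F G. normal_frame br J h a A C D F G"
proof -
  have D: "D = cnj G + cnj A - 1" using t(1) by (simp add: algebra_simps)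
  have K: "K = - B" using t(2) by (simp add: eq_neg_iff_add_eq_0 add.commute)
  note R = trace_frame_real[OF cf la se t]
  show ?thesis
  proof (cases "C = 0")
    case False
    \<comment> \<open>Since \<open>C\<close> is real, \<open>B'\<close> is \<open>cnj B\<close> and
      \<open>K\<close> is \<open>- B\<close>, this single shear cancels all three. Afterwards
      \<open>C\<close> being non-zero forces \<open>A1 = 1/2\<close> and
      \<open>E1 = 0\<close>.\<close>
    define u where "u = B / C"
    define a1 where "a1 X = a X + u * h X" for X
    obtain A1 E1 F1 G1 where cf1: "coframe J h a1" and se1: "structure_eqs br h a1 0 A1 0 0 C D E1 F1 G1 0"
      and t1: "cnj A1 + cnj G1 - D = 1"
    proof (rule that)
      have u: "B - C * u = 0" "B' - C * cnj u = 0" "K + u * C = 0" using False by (simp_all add: u_def K R(2,3))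
      show "coframe J h a1" unfolding a1_def by (rule coframe_shear[OF cf])
      show "structure_eqs br h a1 0 (A - B * cnj u - B' * u + C * u * cnj u) 0 0 C D
        (E - F * cnj u - G * u + K * u * cnj u + u * (A - B * cnj u - B' * u + C * u * cnj u))
        (F - K * u + u * (B - C * u)) (G - K * cnj u + u * (B' - C * cnj u)) 0"
        using structure_shear[OF se, of u, unfolded u(1,2,3)] unfolding a1_def u(1,2) by simp
      show "cnj (A - B * cnj u - B' * u + C * u * cnj u) + cnj (G - K * cnj u + u * (B' - C * cnj u)) - D = 1"
        unfolding D K by (simp add: algebra_simps)
    qed
    note R1 = trace_frame_real[OF cf1 la se1 t1]
    have A1: "A1 = 1/2" using R1(4) False by (simp add: field_simps)
    have D1: "D = cnj G1 - 1/2" using t1 by (auto simp: A1 complex_eq_iff)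
    have E1: "E1 = 0" using jacobi_first(1)[OF cf1 la se1] False by simp
    obtain r where r: "C = of_real r" using R(3) by (metis Reals_cases Reals_cnj_iff)
    \<comment> \<open>The taming equation loses its terms in \<open>z\<close>, \<open>cnj z\<close>
      and \<open>c\<close>; what remains is the closedness of the diagonal form with the same
      \<open>x\<close> and \<open>y\<close>.\<close>
    obtain x y :: real and z c where xy: "x > 0" "y > 0" and
      "\<i> * x * cnj C + \<i> * y * (D - cnj G1) + z * cnj 0 + cnj z * cnj 0 - c * (0 + 0) = 0"
      by (rule taming_coframe[OF cf1 se1 ta])
    then have "\<i> * (x * r + y * (D - cnj G1)) = 0" by (simp add: r algebra_simps)
    then have e: "x * r + y * (D - cnj G1) = 0" by (metis complex_i_not_zero mult_eq_0_iff)
    \<comment> \<open>Otherwise \<open>D = -1\<close>, and the Jacobi identity would make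
      \<open>(cmod F1)\<^sup>2 + 3/4\<close> vanish.\<close>
    have n: "1/2 + G1 \<noteq> 0"
    proof
      assume "1/2 + G1 = 0"
      then have G1: "G1 = - (1/2)" by (simp add: eq_neg_iff_add_eq_0 add.commute)
      have "F1 * cnj F1 + 3/4 = 0"
        using jacobi_second(1)[OF cf1 la se1] by (simp add: A1 D1 G1 add.commute)
      then have "complex_of_real ((cmod F1)\<^sup>2 + 3/4) = 0" by (simp add: complex_norm_square del: of_real_power)
      then have "(cmod F1)\<^sup>2 + 3/4 = 0" by (metis of_real_eq_0_iff)
      then show False by (smt (verit) zero_le_power2 divide_pos_pos)
    qed
    have "normal_frame br J h a1 (1/2) r D F1 G1"
      unfolding normal_frame_def using cf1 se1 xy e n by (auto simp: A1 E1 r D1)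
    then show ?thesis by blast
  next
    case True
    then have B: "B = 0" "B' = 0" "K = 0" using R K by auto
    obtain x y :: real and z c where xy: "x > 0" "y > 0" and
      "\<i> * x * cnj C + \<i> * y * (D - cnj G) + z * cnj K + cnj z * cnj B' - c * (B + K) = 0"
      by (rule taming_coframe[OF cf se ta])
    \<comment> \<open>Only the term \<open>y * (D - cnj G)\<close> of the taming equation is left,
      and \<open>y > 0\<close>.\<close>
    then have DG: "D = cnj G" using True B by simp
    then have A: "A = 1" using D R(1) by simp
    have F2: "F * cnj F = G + cnj G" using jacobi_second(1)[OF cf la se] by (simp add: A B DG algebra_simps)
    have FG: "F * (1 - 2 * G) = 0" using jacobi_second(2)[OF cf la se] by (simp add: A B DG algebra_simps)
    have F3: "(cmod F)\<^sup>2 = 2 * Re G"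
    proof -
      have "complex_of_real ((cmod F)\<^sup>2) = of_real (2 * Re G)"
        using F2 by (simp add: complex_norm_square complex_add_cnj del: of_real_power)
      then show ?thesis using of_real_eq_iff by blast
    qed
    then have ReG: "Re G \<ge> 0" by (smt (verit) zero_le_power2)
    \<comment> \<open>This is the solvability condition for the shear that removes \<open>E\<close>.
      Either \<open>F = 0\<close> and \<open>G\<close> is imaginary, or \<open>G = 1/2\<close> and
      \<open>F\<close> has modulus 1.\<close>
    have "cmod F \<noteq> cmod (1 - G)"
    proof (cases "F = 0")
      case True
      then have "Re G = 0" using F3 by simp
      then have "1 - G \<noteq> 0" by (auto simp: complex_eq_iff)
      then show ?thesis using True by simp
    next
      case False
      then have G: "G = 1/2" using FG by (simp add: eq_divide_eq mult.commute)
      have "(cmod F)\<^sup>2 = 1" unfolding F3 G by simp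
      moreover have "cmod (1 - G) = 1/2" unfolding G by simp
      moreover have "cmod F = 1" using \<open>(cmod F)\<^sup>2 = 1\<close> power2_eq_imp_eq[of "cmod F" 1] by simp
      ultimately show ?thesis by simp
    qed
    then obtain u where u: "E + (1 - G) * u - F * cnj u = 0" by (rule solve_antilinear)
    have E1: "E - F * cnj u - G * u + u = 0" using u by (simp add: algebra_simps)
    have "1 + G \<noteq> 0" using ReG by (auto simp: complex_eq_iff)
    then have "normal_frame br J h (\<lambda>X. a X + u * h X) 1 0 D F G"
      unfolding normal_frame_def
      using coframe_shear[OF cf, of u] structure_shear[OF se, of u] E1 True
      by (auto simp: A B DG intro!: exI[of _ "1::real"])
    then show ?thesis by blast
  qed
qed

lemma normal_frame_exists:
  assumes "lie_algebra br" "dim (UNIV :: 'a::real_vector set) = 4" "complex_structure br (J :: 'a \<Rightarrow> 'a)"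
    "taming_symplectic_form br J \<Omega>"
  obtains h a A C D F G where "normal_frame br J h a A C D F G"
proof -
  obtain h a A B B' C D E F G K where f:
    "coframe J h a" "structure_eqs br h a 0 A B B' C D E F G K"
    by (rule coframe_without_20[OF assms(1-3)])
  have "\<exists>h a A C D F G. normal_frame br J h a A C D F G"
  proof (cases "cnj A + cnj G - D = 0 \<and> B + K = 0")
    case True
    then show ?thesis using normal_frame_unimodular[OF f(1) assms(1) f(2) assms(4)] by blast
  next
    case False
    obtain h a A B B' C D E F G K where
      "coframe J h a" "structure_eqs br h a 0 A B B' C D E F G K" "cnj A + cnj G - D = 1" "B + K = 0"
      by (rule trace_frame[OF f(1) assms(1) f(2) False])
    then show ?thesis using normal_frame_nonunimodular[OF _ assms(1) _ assms(4)] by blast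
  qed
  then show ?thesis using that by blast
qed

section \<open>Forms of pure type\<close>

fun tensor :: "('a \<Rightarrow> complex) list \<Rightarrow> 'a list \<Rightarrow> complex" where
  "tensor [] [] = 1"
| "tensor (\<phi> # \<phi>s) (X # Xs) = \<phi> X * tensor \<phi>s Xs"
| "tensor _ _ = 0"

lemma tensor_eq: "tensor \<phi>s Xs = (if length Xs = length \<phi>s then \<Prod>i<length \<phi>s. (\<phi>s ! i) (Xs ! i) else 0)"
  by (induction \<phi>s Xs rule: tensor.induct) (auto simp: prod.lessThan_Suc_shift simp del: prod.lessThan_Suc)

lemma cext_cong:
  "(\<And>Xs. length Xs = length Zs \<Longrightarrow> \<alpha> Xs = \<beta> Xs) \<Longrightarrow> cext Zs \<alpha> = cext Zs \<beta>"
proof (induction Zs arbitrary: \<alpha> \<beta>)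
  case (Cons Z Zs)
  have "cext Zs (\<lambda>Xs. \<alpha> (v # Xs)) = cext Zs (\<lambda>Xs. \<beta> (v # Xs))" for v
    by (rule Cons.IH) (simp add: Cons.prems)
  then show ?case by simp
qed simp

lemma cext_add: "cext Zs (\<lambda>Xs. \<alpha> Xs + \<beta> Xs) = cext Zs \<alpha> + cext Zs \<beta>"
  by (induction Zs arbitrary: \<alpha> \<beta>) (simp_all add: algebra_simps)

lemma cext_mult: "cext Zs (\<lambda>Xs. c * \<alpha> Xs) = c * cext Zs \<alpha>"
  by (induction Zs arbitrary: \<alpha>) (simp_all add: algebra_simps)

lemma cext_zero: "cext Zs (\<lambda>_. 0) = 0"
  by (induction Zs) simp_all

lemma cext_tensor:
  "length Zs = length \<phi>s \<Longrightarrow>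
    cext Zs (tensor \<phi>s) = (\<Prod>i<length \<phi>s. (\<phi>s ! i) (fst (Zs ! i)) + \<i> * (\<phi>s ! i) (snd (Zs ! i)))"
proof (induction \<phi>s arbitrary: Zs)
  case (Cons \<phi> \<phi>s)
  then obtain Z Zs' where Zs: "Zs = Z # Zs'" "length Zs' = length \<phi>s" by (cases Zs) auto
  then show ?case
    using Cons.IH[OF Zs(2)] by (simp add: cext_mult prod.lessThan_Suc_shift distrib_right del: prod.lessThan_Suc)
qed simp

lemma pq_part_cong:
  "(\<And>Xs. length Xs = p + q \<Longrightarrow> \<alpha> Xs = \<beta> Xs) \<Longrightarrow> pq_part J p q \<alpha> = pq_part J p q \<beta>"
  by (auto simp: pq_part_def fun_eq_iff intro!: sum.cong cext_cong)

lemma pq_part_add: "pq_part J p q (\<lambda>Xs. \<alpha> Xs + \<beta> Xs) = (\<lambda>Xs. pq_part J p q \<alpha> Xs + pq_part J p q \<beta> Xs)"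
  by (auto simp: pq_part_def fun_eq_iff cext_add sum.distrib)

lemma pq_part_mult: "pq_part J p q (\<lambda>Xs. c * \<alpha> Xs) = (\<lambda>Xs. c * pq_part J p q \<alpha> Xs)"
  by (auto simp: pq_part_def fun_eq_iff cext_mult sum_distrib_left)

lemma pq_part_zero: "pq_part J p q (\<lambda>_. 0) = (\<lambda>_. 0)"
  by (auto simp: pq_part_def fun_eq_iff cext_zero)

text \<open>Prescribing the components in all bidegrees, of every total degree, leaves a single
  summand in \<open>del\<close> and \<open>delbar\<close>.\<close>

definition pure_type :: "('a::real_vector \<Rightarrow> 'a) \<Rightarrow> nat \<Rightarrow> nat \<Rightarrow> ('a list \<Rightarrow> complex) \<Rightarrow> bool" where
  "pure_type J p q \<alpha> \<longleftrightarrow>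
    (\<forall>p' q'. pq_part J p' q' \<alpha> = (if p' = p \<and> q' = q then \<alpha> else (\<lambda>_. 0)))"

lemma pure_type_add:
  "pure_type J p q \<alpha> \<Longrightarrow> pure_type J p q \<beta> \<Longrightarrow> pure_type J p q (\<lambda>Xs. \<alpha> Xs + \<beta> Xs)"
  by (auto simp: pure_type_def pq_part_add)

lemma pure_type_mult: "pure_type J p q \<alpha> \<Longrightarrow> pure_type J p q (\<lambda>Xs. c * \<alpha> Xs)"
  by (auto simp: pure_type_def pq_part_mult)

lemma pure_type_diff:
  "pure_type J p q \<alpha> \<Longrightarrow> pure_type J p q \<beta> \<Longrightarrow> pure_type J p q (\<lambda>Xs. \<alpha> Xs - \<beta> Xs)"
  using pure_type_add[OF _ pure_type_mult[of J p q \<beta> "-1"]] by simp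

definition one_form :: "('a::real_vector \<Rightarrow> 'a) \<Rightarrow> bool \<Rightarrow> ('a \<Rightarrow> complex) \<Rightarrow> bool" where
  "one_form J b \<phi> \<longleftrightarrow> linear \<phi> \<and> (\<forall>X. \<phi> (J X) = (if b then \<i> else - \<i>) * \<phi> X)"

lemma one_form_vec:
  assumes "one_form J b \<phi>"
  shows "\<phi> (fst (vec10 J X)) + \<i> * \<phi> (snd (vec10 J X)) = (if b then \<phi> X else 0)"
    "\<phi> (fst (vec01 J X)) + \<i> * \<phi> (snd (vec01 J X)) = (if b then 0 else \<phi> X)"
  using assms
  by (auto simp: one_form_def vec10_def vec01_def linear_scale linear_neg scaleR_conv_of_real)

text \<open>For each choice \<open>S\<close> of the positions of type (1,0), the extension of the
  tensor is a product with a zero factor wherever \<open>S\<close> and \<open>bs\<close> disagree.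
  So only \<open>S = T\<close> survives, a set with \<open>p\<close> elements.\<close>

lemma pure_type_tensor:
  assumes "list_all2 (one_form J) bs \<phi>s" "length (filter id bs) = p" "length \<phi>s = p + q"
  shows "pure_type J p q (tensor \<phi>s)"
  unfolding pure_type_def
proof (intro allI ext)
  fix p' q' Xs
  let ?n = "length \<phi>s"
  define T where "T = {i. i < ?n \<and> bs ! i}"
  have lb: "length bs = ?n" using assms(1) by (rule list_all2_lengthD)
  have cT: "card T = p" using assms(2) lb by (simp add: length_filter_conv_card T_def)
  show "pq_part J p' q' (tensor \<phi>s) Xs = (if p' = p \<and> q' = q then tensor \<phi>s else (\<lambda>_. 0)) Xs"
  proof (cases "length Xs = p' + q' \<and> p' + q' = ?n")
    case False
    then consider "length Xs \<noteq> p' + q'" | "length Xs = p' + q'" "p' + q' \<noteq> ?n" by blast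
    then show ?thesis
    proof cases
      case 1
      then show ?thesis using assms(3) by (auto simp: pq_part_def tensor_eq)
    next
      case 2
      have "pq_part J p' q' (tensor \<phi>s) = pq_part J p' q' (\<lambda>_. 0)"
        by (rule pq_part_cong) (use 2 in \<open>simp add: tensor_eq\<close>)
      then show ?thesis using 2 assms(3) by (auto simp: pq_part_zero)
    qed
  next
    case True
    have *: "cext (map (\<lambda>i. if i \<in> S then vec10 J (Xs ! i) else vec01 J (Xs ! i)) [0..<?n]) (tensor \<phi>s)
       = (if S = T then tensor \<phi>s Xs else 0)" if S: "S \<subseteq> {..<?n}" for S
    proof -
      have of: "one_form J (bs ! i) (\<phi>s ! i)" if "i < ?n" for i
        using assms(1) that lb by (simp add: list_all2_conv_all_nth)
      have "cext (map (\<lambda>i. if i \<in> S then vec10 J (Xs ! i) else vec01 J (Xs ! i)) [0..<?n]) (tensor \<phi>s)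
        = (\<Prod>i<?n. if (i \<in> S) = bs ! i then (\<phi>s ! i) (Xs ! i) else 0)"
        by (subst cext_tensor) (auto intro!: prod.cong simp: one_form_vec[OF of])
      also have "\<dots> = (if S = T then tensor \<phi>s Xs else 0)"
      proof (cases "S = T")
        case True2: True
        then show ?thesis using True by (auto simp: tensor_eq T_def intro!: prod.cong)
      next
        case False
        then obtain i where "i < ?n" "(i \<in> S) \<noteq> bs ! i" using S by (auto simp: T_def)
        then show ?thesis using False by (auto intro!: prod_zero bexI[of _ i])
      qed
      finally show ?thesis .
    qed
    have "pq_part J p' q' (tensor \<phi>s) Xs =
        (\<Sum>S | S \<subseteq> {..<?n} \<and> card S = p'. if S = T then tensor \<phi>s Xs else 0)"
      unfolding pq_part_def using True * by (auto intro!: sum.cong simp del: sum.delta)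
    also have "\<dots> = (if T \<subseteq> {..<?n} \<and> card T = p' then tensor \<phi>s Xs else 0)"
      by (subst sum.delta) auto
    finally have "pq_part J p' q' (tensor \<phi>s) Xs = (if T \<subseteq> {..<?n} \<and> card T = p' then tensor \<phi>s Xs else 0)" .
    moreover have "T \<subseteq> {..<?n}" by (auto simp: T_def)
    ultimately show ?thesis using True assms(3) by (auto simp: cT)
  qed
qed

lemma ce_diff_zero: "ce_diff br (\<lambda>_. 0) = (\<lambda>_. 0)"
  by (simp add: ce_diff_def fun_eq_iff)

lemma del_pure:
  assumes "pure_type J p q \<alpha>"
  shows "del br J \<alpha> = pq_part J (p + 1) q (ce_diff br \<alpha>)"
    "delbar br J \<alpha> = pq_part J p (q + 1) (ce_diff br \<alpha>)"
proof -
  have fin: "finite {(p, q). p + q + 1 = (n::nat)}" for n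
    by (rule finite_subset[of _ "{..n} \<times> {..n}"]) auto
  have t: "pq_part J p' q' \<alpha> = (if (p', q') = (p, q) then \<alpha> else (\<lambda>_. 0))" for p' q'
    using assms by (simp add: pure_type_def)
  have *: "(\<Sum>(p', q') | p' + q' + 1 = n. F p' q' (pq_part J p' q' \<alpha>)) =
      (if p + q + 1 = n then F p q \<alpha> else 0)" if "\<And>p' q'. F p' q' (\<lambda>_. 0) = 0"
    for n and F :: "nat \<Rightarrow> nat \<Rightarrow> ('a list \<Rightarrow> complex) \<Rightarrow> complex"
  proof -
    have F: "F p' q' (pq_part J p' q' \<alpha>) = (if (p', q') = (p, q) then F p q \<alpha> else 0)" for p' q'
      using t[of p' q'] that[of p' q'] by (cases "(p', q') = (p, q)") auto
    have "(\<Sum>(p', q') | p' + q' + 1 = n. F p' q' (pq_part J p' q' \<alpha>)) =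
      (\<Sum>r\<in>{(p', q'). p' + q' + 1 = n}. if r = (p, q) then F p q \<alpha> else 0)"
      by (intro sum.cong refl) (simp add: F split: prod.split)
    also have "\<dots> = (if p + q + 1 = n then F p q \<alpha> else 0)"
      by (subst sum.delta[OF fin]) auto
    finally show ?thesis .
  qed
  show "del br J \<alpha> = pq_part J (p + 1) q (ce_diff br \<alpha>)"
  proof (rule ext)
    fix Xs
    show "del br J \<alpha> Xs = pq_part J (p + 1) q (ce_diff br \<alpha>) Xs"
      unfolding del_def by (subst *) (auto simp: ce_diff_zero pq_part_zero, auto simp: pq_part_def)
  qed
  show "delbar br J \<alpha> = pq_part J p (q + 1) (ce_diff br \<alpha>)"
  proof (rule ext)
    fix Xs
    show "delbar br J \<alpha> Xs = pq_part J p (q + 1) (ce_diff br \<alpha>) Xs"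
      unfolding delbar_def by (subst *) (auto simp: ce_diff_zero pq_part_zero, auto simp: pq_part_def)
  qed
qed

definition wedge2 ::
    "('a \<Rightarrow> complex) \<Rightarrow> ('a \<Rightarrow> complex) \<Rightarrow> 'a list \<Rightarrow> complex" where
  "wedge2 \<phi> \<psi> Xs = tensor [\<phi>, \<psi>] Xs - tensor [\<psi>, \<phi>] Xs"

definition wedge3 ::
    "('a \<Rightarrow> complex) \<Rightarrow> ('a \<Rightarrow> complex) \<Rightarrow> ('a \<Rightarrow> complex) \<Rightarrow> 'a list \<Rightarrow> complex" where
  "wedge3 \<phi> \<psi> \<eta> Xs =
    tensor [\<phi>, \<psi>, \<eta>] Xs - tensor [\<phi>, \<eta>, \<psi>] Xs - (tensor [\<psi>, \<phi>, \<eta>] Xs - tensor [\<psi>, \<eta>, \<phi>] Xs)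
    + (tensor [\<eta>, \<phi>, \<psi>] Xs - tensor [\<eta>, \<psi>, \<phi>] Xs)"

text \<open>\<open>\<rho> \<otimes> (\<phi> \<and> \<psi> \<and> \<eta>)\<close>, a summand in the expansion of a 4-fold wedge product.\<close>

definition wedge4_at ::
    "('a \<Rightarrow> complex) \<Rightarrow> ('a \<Rightarrow> complex) \<Rightarrow>
     ('a \<Rightarrow> complex) \<Rightarrow> ('a \<Rightarrow> complex) \<Rightarrow> 'a list \<Rightarrow> complex" where
  "wedge4_at \<rho> \<phi> \<psi> \<eta> Xs =
    tensor [\<rho>, \<phi>, \<psi>, \<eta>] Xs - tensor [\<rho>, \<phi>, \<eta>, \<psi>] Xs - (tensor [\<rho>, \<psi>, \<phi>, \<eta>] Xs - tensor [\<rho>, \<psi>, \<eta>, \<phi>] Xs)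
    + (tensor [\<rho>, \<eta>, \<phi>, \<psi>] Xs - tensor [\<rho>, \<eta>, \<psi>, \<phi>] Xs)"

definition wedge4 ::
    "('a \<Rightarrow> complex) \<Rightarrow> ('a \<Rightarrow> complex) \<Rightarrow>
     ('a \<Rightarrow> complex) \<Rightarrow> ('a \<Rightarrow> complex) \<Rightarrow> 'a list \<Rightarrow> complex" where
  "wedge4 \<phi> \<psi> \<eta> \<rho> Xs = wedge4_at \<phi> \<psi> \<eta> \<rho> Xs - wedge4_at \<psi> \<phi> \<eta> \<rho> Xs
     + (wedge4_at \<eta> \<phi> \<psi> \<rho> Xs - wedge4_at \<rho> \<phi> \<psi> \<eta> Xs)"

lemma pure_type_wedge2:
  assumes "one_form J b1 \<phi>1" "one_form J b2 \<phi>2" "of_bool b1 + of_bool b2 = p" "p + q = 2"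
  shows "pure_type J p q (wedge2 \<phi>1 \<phi>2)"
proof -
  have "pure_type J p q (tensor [\<phi>1, \<phi>2])" by (rule pure_type_tensor[of J "[b1, b2]"]) (use assms in auto)
  moreover have "pure_type J p q (tensor [\<phi>2, \<phi>1])" by (rule pure_type_tensor[of J "[b2, b1]"]) (use assms in auto)
  ultimately show ?thesis unfolding wedge2_def by (intro pure_type_diff)
qed

lemma pure_type_wedge3:
  assumes "one_form J b1 \<phi>1" "one_form J b2 \<phi>2" "one_form J b3 \<phi>3"
    "of_bool b1 + of_bool b2 + of_bool b3 = p" "p + q = 3"
  shows "pure_type J p q (wedge3 \<phi>1 \<phi>2 \<phi>3)"
proof -
  have m: "pure_type J p q (tensor [\<psi>1, \<psi>2, \<psi>3])"
    if "one_form J c1 \<psi>1" "one_form J c2 \<psi>2" "one_form J c3 \<psi>3"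
      "of_bool c1 + of_bool c2 + of_bool c3 = p" for c1 c2 c3 \<psi>1 \<psi>2 \<psi>3
    by (rule pure_type_tensor[of J "[c1, c2, c3]"]) (use assms(5) that in auto)
  show ?thesis unfolding wedge3_def
    by (intro pure_type_diff pure_type_add; rule m, rule assms, rule assms, rule assms) (use assms(4) in auto)
qed

lemma pure_type_wedge4_at:
  assumes "one_form J b1 \<phi>1" "one_form J b2 \<phi>2" "one_form J b3 \<phi>3" "one_form J b4 \<phi>4"
    "of_bool b1 + of_bool b2 + of_bool b3 + of_bool b4 = p" "p + q = 4"
  shows "pure_type J p q (wedge4_at \<phi>1 \<phi>2 \<phi>3 \<phi>4)"
proof -
  have m: "pure_type J p q (tensor [\<phi>1, \<psi>2, \<psi>3, \<psi>4])"
    if "one_form J c2 \<psi>2" "one_form J c3 \<psi>3" "one_form J c4 \<psi>4"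
      "of_bool b1 + of_bool c2 + of_bool c3 + of_bool c4 = p" for c2 c3 c4 \<psi>2 \<psi>3 \<psi>4
    by (rule pure_type_tensor[of J "[b1, c2, c3, c4]"]) (use assms(1,6) that in auto)
  show ?thesis unfolding wedge4_at_def
    by (intro pure_type_diff pure_type_add; rule m, rule assms, rule assms, rule assms) (use assms(5) in auto)
qed

lemma pure_type_wedge4:
  assumes "one_form J b1 \<phi>1" "one_form J b2 \<phi>2" "one_form J b3 \<phi>3" "one_form J b4 \<phi>4"
    "of_bool b1 + of_bool b2 + of_bool b3 + of_bool b4 = p" "p + q = 4"
  shows "pure_type J p q (wedge4 \<phi>1 \<phi>2 \<phi>3 \<phi>4)"
  unfolding wedge4_def
  by (intro pure_type_diff pure_type_add;
      rule pure_type_wedge4_at, rule assms, rule assms, rule assms, rule assms) (use assms(5,6) in auto)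

section \<open>Differentials in a normal frame\<close>

lemma wedge2_pair: "wedge2 \<phi> \<psi> [X, Y] = wedge_at \<phi> \<psi> X Y"
  by (simp add: wedge2_def wedge_at_def)

lemma one_form_coframe:
  assumes "coframe J h a"
  shows "one_form J True h" "one_form J True a" "one_form J False (cnj_form h)" "one_form J False (cnj_form a)"
proof -
  have l: "linear h" "linear a" and c: "\<And>X. h (J X) = \<i> * h X" "\<And>X. a (J X) = \<i> * a X"
    using assms by (auto simp: coframe_def)
  have "linear (cnj_form h)" "linear (cnj_form a)"
    by (auto intro!: linearI simp: cnj_form_def linear_add[OF l(1)] linear_add[OF l(2)] linear_scale[OF l(1)] linear_scale[OF l(2)])
  then show "one_form J True h" "one_form J True a" "one_form J False (cnj_form h)" "one_form J False (cnj_form a)"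
    using l by (auto simp: one_form_def c cnj_form_def)
qed

lemma ce_diff_3: "ce_diff br \<alpha> [X, Y, Z] = - \<alpha> [br X Y, Z] + \<alpha> [br X Z, Y] - \<alpha> [br Y Z, X]"
  by (simp add: ce_diff_def eval_nat_numeral lessThan_Suc greaterThanLessThan_def nths_Cons)

lemma ce_diff_4: "ce_diff br \<alpha> [X, Y, Z, V] = - \<alpha> [br X Y, Z, V] + \<alpha> [br X Z, Y, V] - \<alpha> [br X V, Y, Z]
    - \<alpha> [br Y Z, X, V] + \<alpha> [br Y V, X, Z] - \<alpha> [br Z V, X, Y]"
proof -
  have "{0<..<Suc (Suc (Suc (Suc 0)))} = {Suc 0, Suc (Suc 0), Suc (Suc (Suc 0))}"
    "{Suc 0<..<Suc (Suc (Suc (Suc 0)))} = {Suc (Suc 0), Suc (Suc (Suc 0))}"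
    "{Suc (Suc 0)<..<Suc (Suc (Suc (Suc 0)))} = {Suc (Suc (Suc 0))}"
    "{Suc (Suc (Suc 0))<..<Suc (Suc (Suc (Suc 0)))} = {}"
    by auto
  then show ?thesis
    by (simp add: ce_diff_def eval_nat_numeral lessThan_Suc nths_Cons)
qed

definition form11 ::
    "('a \<Rightarrow> complex) \<Rightarrow> ('a \<Rightarrow> complex) \<Rightarrow> complex \<Rightarrow> complex \<Rightarrow> complex \<Rightarrow> complex \<Rightarrow> 'a list \<Rightarrow> complex" where
  "form11 h a c1 c2 c3 c4 Xs = c1 * wedge2 h (cnj_form h) Xs + c2 * wedge2 h (cnj_form a) Xs
     + c3 * wedge2 a (cnj_form h) Xs + c4 * wedge2 a (cnj_form a) Xs"

definition form21 ::
    "('a \<Rightarrow> complex) \<Rightarrow> ('a \<Rightarrow> complex) \<Rightarrow> complex \<Rightarrow> complex \<Rightarrow> 'a list \<Rightarrow> complex" where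
  "form21 h a c1 c2 Xs = c1 * wedge3 h a (cnj_form h) Xs + c2 * wedge3 h a (cnj_form a) Xs"

definition form12 ::
    "('a \<Rightarrow> complex) \<Rightarrow> ('a \<Rightarrow> complex) \<Rightarrow> complex \<Rightarrow> complex \<Rightarrow> 'a list \<Rightarrow> complex" where
  "form12 h a c1 c2 Xs = c1 * wedge3 h (cnj_form h) (cnj_form a) Xs + c2 * wedge3 a (cnj_form h) (cnj_form a) Xs"

text \<open>By integrability only the bidegrees (2,1) and (1,2) occur. Triples suffice, because
  \<open>pq_part\<close> in total degree 3 reads no other lists.\<close>

lemma ce_diff_11:
  assumes "structure_eqs br h a 0 (complex_of_real A) 0 0 (complex_of_real C) D 0 F G 0"
  shows "ce_diff br (form11 h a c1 c2 c3 c4) [X, Y, Z] =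
    form21 h a (c2 * cnj F + c3 * (D - A)) (c1 * C + c4 * (D - cnj G)) [X, Y, Z] +
    form12 h a (c2 * (A - cnj D) - c3 * F) (- c1 * C + c4 * (G - cnj D)) [X, Y, Z]"
proof -
  note s = assms[unfolded structure_eqs_def wedge_at_def cnj_form_def, THEN conjunct1, rule_format]
     assms[unfolded structure_eqs_def wedge_at_def cnj_form_def, THEN conjunct2, rule_format]
  show ?thesis
    unfolding ce_diff_3 form11_def form21_def form12_def wedge2_def wedge3_def
    by (simp add: s cnj_form_def algebra_simps)
qed

lemma ce_diff_20:
  assumes "structure_eqs br h a 0 (complex_of_real A) 0 0 (complex_of_real C) D 0 F G 0"
  shows "ce_diff br (\<lambda>Xs. c * wedge2 h a Xs) [X, Y, Z] = form21 h a (- c * (A + G)) 0 [X, Y, Z]"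
proof -
  note s = assms[unfolded structure_eqs_def wedge_at_def cnj_form_def, THEN conjunct1, rule_format]
     assms[unfolded structure_eqs_def wedge_at_def cnj_form_def, THEN conjunct2, rule_format]
  show ?thesis
    unfolding ce_diff_3 form21_def wedge2_def wedge3_def
    by (simp add: s cnj_form_def algebra_simps)
qed

text \<open>On the contraction of the volume form with a vector X, d is, up to sign, multiplication
  of the volume form by tr (ad X). The trace form has no component along \<open>a\<close>, so the
  first 3-form is closed; the second yields its coefficient at \<open>h\<close>.\<close>

lemma ce_diff_12:
  assumes "structure_eqs br h a 0 (complex_of_real A) 0 0 (complex_of_real C) D 0 F G 0"
  shows "ce_diff br (form12 h a c1 c2) [X, Y, Z, V] =
    - c2 * (A + cnj G - D) * wedge4 h a (cnj_form h) (cnj_form a) [X, Y, Z, V]"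
proof -
  note s = assms[unfolded structure_eqs_def wedge_at_def cnj_form_def, THEN conjunct1, rule_format]
     assms[unfolded structure_eqs_def wedge_at_def cnj_form_def, THEN conjunct2, rule_format]
  have 1: "ce_diff br (wedge3 h (cnj_form h) (cnj_form a)) [X, Y, Z, V] = 0"
    unfolding ce_diff_4 wedge3_def
    by (simp add: s cnj_form_def algebra_simps)
  have 2: "ce_diff br (wedge3 a (cnj_form h) (cnj_form a)) [X, Y, Z, V] =
    - (A + cnj G - D) * wedge4 h a (cnj_form h) (cnj_form a) [X, Y, Z, V]"
    unfolding ce_diff_4 wedge3_def wedge4_def wedge4_at_def
    by (simp add: s cnj_form_def algebra_simps)
  have "ce_diff br (form12 h a c1 c2) [X, Y, Z, V] =
     c1 * ce_diff br (wedge3 h (cnj_form h) (cnj_form a)) [X, Y, Z, V] + c2 * ce_diff br (wedge3 a (cnj_form h) (cnj_form a)) [X, Y, Z, V]"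
    unfolding ce_diff_4 form12_def by (simp add: algebra_simps)
  then show ?thesis unfolding 1 2 by (simp add: algebra_simps)
qed

lemma list_length_3: "length Xs = 3 \<longleftrightarrow> (\<exists>X Y Z. Xs = [X, Y, Z])"
  by (auto simp: eval_nat_numeral length_Suc_conv)

lemma list_length_4: "length Xs = 4 \<longleftrightarrow> (\<exists>X Y Z V. Xs = [X, Y, Z, V])"
  by (auto simp: eval_nat_numeral length_Suc_conv)

lemma pure_type_forms:
  assumes "coframe J h a"
  shows "pure_type J 1 1 (form11 h a c1 c2 c3 c4)" "pure_type J 2 1 (form21 h a c1 c2)"
    "pure_type J 1 2 (form12 h a c1 c2)" "pure_type J 2 0 (\<lambda>Xs. c * wedge2 h a Xs)"
    "pure_type J 2 2 (wedge4 h a (cnj_form h) (cnj_form a))"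
proof -
  note o = one_form_coframe[OF assms]
  show "pure_type J 1 1 (form11 h a c1 c2 c3 c4)" unfolding form11_def[abs_def]
    by (intro pure_type_add pure_type_mult pure_type_wedge2[OF o(1) o(3)] pure_type_wedge2[OF o(1) o(4)]
       pure_type_wedge2[OF o(2) o(3)] pure_type_wedge2[OF o(2) o(4)]) simp_all
  show "pure_type J 2 1 (form21 h a c1 c2)" unfolding form21_def[abs_def]
    by (intro pure_type_add pure_type_mult pure_type_wedge3[OF o(1) o(2) o(3)] pure_type_wedge3[OF o(1) o(2) o(4)]) simp_all
  show "pure_type J 1 2 (form12 h a c1 c2)" unfolding form12_def[abs_def]
    by (intro pure_type_add pure_type_mult pure_type_wedge3[OF o(1) o(3) o(4)] pure_type_wedge3[OF o(2) o(3) o(4)]) simp_all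
  show "pure_type J 2 0 (\<lambda>Xs. c * wedge2 h a Xs)"
    by (intro pure_type_mult pure_type_wedge2[OF o(1) o(2)]) simp_all
  show "pure_type J 2 2 (wedge4 h a (cnj_form h) (cnj_form a))"
    by (intro pure_type_wedge4[OF o]) simp_all
qed

lemma pq_part_sum_pure:
  assumes "pure_type J p q \<alpha>" "pure_type J p' q' \<beta>" "(p, q) \<noteq> (p', q')"
    "\<And>Xs. length Xs = p + q \<Longrightarrow> \<gamma> Xs = \<alpha> Xs + \<beta> Xs"
  shows "pq_part J p q \<gamma> = \<alpha>"
proof -
  have "pq_part J p q \<gamma> = pq_part J p q (\<lambda>Xs. \<alpha> Xs + \<beta> Xs)" by (rule pq_part_cong) (rule assms(4))
  then show ?thesis using assms(1-3) by (auto simp: pq_part_add pure_type_def)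
qed

lemma del_11:
  assumes cf: "coframe J h a" and se: "structure_eqs br h a 0 (complex_of_real A) 0 0 (complex_of_real C) D 0 F G 0"
  shows "del br J (form11 h a c1 c2 c3 c4) = form21 h a (c2 * cnj F + c3 * (D - A)) (c1 * C + c4 * (D - cnj G))"
    "delbar br J (form11 h a c1 c2 c3 c4) = form12 h a (c2 * (A - cnj D) - c3 * F) (- c1 * C + c4 * (G - cnj D))"
proof -
  let ?d = "ce_diff br (form11 h a c1 c2 c3 c4)"
  let ?d21 = "form21 h a (c2 * cnj F + c3 * (D - A)) (c1 * C + c4 * (D - cnj G))"
  let ?d12 = "form12 h a (c2 * (A - cnj D) - c3 * F) (- c1 * C + c4 * (G - cnj D))"
  have d: "?d Xs = ?d21 Xs + ?d12 Xs" if "length Xs = 3" for Xs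
    using that by (auto simp: list_length_3 ce_diff_11[OF se])
  have "pq_part J 2 1 ?d = ?d21"
    by (rule pq_part_sum_pure[OF pure_type_forms(2)[OF cf] pure_type_forms(3)[OF cf]]) (simp_all add: d)
  moreover have "pq_part J 1 2 ?d = ?d12"
    by (rule pq_part_sum_pure[OF pure_type_forms(3)[OF cf] pure_type_forms(2)[OF cf]]) (simp_all add: d)
  ultimately show "del br J (form11 h a c1 c2 c3 c4) = ?d21" "delbar br J (form11 h a c1 c2 c3 c4) = ?d12"
    by (simp_all only: del_pure[OF pure_type_forms(1)[OF cf]] one_add_one)
qed

text \<open>In complex dimension 2 there are no non-zero (3,0)-forms, so every multiple of h \<and>
  a is a candidate for the form \<open>\<beta>\<close> of
  \<open>induces_taming_symplectic_form\<close>.\<close>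

lemma del_20:
  assumes cf: "coframe J h a" and se: "structure_eqs br h a 0 (complex_of_real A) 0 0 (complex_of_real C) D 0 F G 0"
  shows "del br J (\<lambda>Xs. c * wedge2 h a Xs) = (\<lambda>_. 0)"
    "delbar br J (\<lambda>Xs. c * wedge2 h a Xs) = form21 h a (- c * (A + G)) 0"
proof -
  have e: "pq_part J p q (ce_diff br (\<lambda>Xs. c * wedge2 h a Xs)) = pq_part J p q (form21 h a (- c * (A + G)) 0)"
    if "p + q = 3" for p q
    by (rule pq_part_cong) (auto simp: that list_length_3 ce_diff_20[OF se])
  show "del br J (\<lambda>Xs. c * wedge2 h a Xs) = (\<lambda>_. 0)"
    "delbar br J (\<lambda>Xs. c * wedge2 h a Xs) = form21 h a (- c * (A + G)) 0"
    unfolding del_pure[OF pure_type_forms(4)[OF cf]] using pure_type_forms(2)[OF cf]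
    by (simp_all add: e pure_type_def)
qed

lemma del_12:
  assumes cf: "coframe J h a" and se: "structure_eqs br h a 0 (complex_of_real A) 0 0 (complex_of_real C) D 0 F G 0"
  shows "del br J (form12 h a c1 c2) = (\<lambda>Xs. - c2 * (A + cnj G - D) * wedge4 h a (cnj_form h) (cnj_form a) Xs)"
proof -
  have "pq_part J 2 2 (ce_diff br (form12 h a c1 c2)) =
      pq_part J 2 2 (\<lambda>Xs. - c2 * (A + cnj G - D) * wedge4 h a (cnj_form h) (cnj_form a) Xs)"
    by (rule pq_part_cong) (auto simp: list_length_4 ce_diff_12[OF se])
  also have "\<dots> = (\<lambda>Xs. - c2 * (A + cnj G - D) * wedge4 h a (cnj_form h) (cnj_form a) Xs)"
    using pure_type_mult[OF pure_type_forms(5)[OF cf]] unfolding pure_type_def by (metis (full_types))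
  finally show ?thesis
    unfolding del_pure[OF pure_type_forms(3)[OF cf]] by (simp add: numeral_2_eq_2)
qed

section \<open>From normal frames to Kaehler metrics and taming forms\<close>

lemma hermitian_alternating:
  assumes g: "hermitian_metric J g" and J: "linear J" "\<And>X. J (J X) = - X"
  shows "bilinear (\<lambda>X Y. g (J X) Y)" "g (J X) X = 0"
proof -
  have gb: "bilinear g" and gs: "g X Y = g Y X" and gJ: "g (J X) (J Y) = g X Y" for X Y
    using g by (auto simp: hermitian_metric_def inner_product_def)
  show "bilinear (\<lambda>X Y. g (J X) Y)"
    by (auto simp: bilinear_def intro!: linearI simp: bilinear_ladd[OF gb] bilinear_radd[OF gb]
       bilinear_lmul[OF gb] bilinear_rmul[OF gb] linear_add[OF J(1)] linear_scale[OF J(1)])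
  show "g (J X) X = 0"
  proof -
    have "g (J X) X = g (J (J X)) (J X)" by (simp add: gJ)
    also have "\<dots> = - g (J X) X" by (simp add: J(2) bilinear_lneg[OF gb] gs[of X "J X"])
    finally show ?thesis by simp
  qed
qed

text \<open>The fundamental form is \<open>J\<close>-invariant, whereas applying \<open>J\<close> to
  both arguments changes the sign of (2,0)- and (0,2)-forms. Hence the coefficient \<open>c\<close>
  vanishes.\<close>

lemma hermitian_form11:
  assumes cf: "coframe J h a" and J: "linear J" "\<And>X. J (J X) = - X" and g: "hermitian_metric J g"
  obtains x y :: real and z where
    "complex_form (fundamental_form J g) = form11 h a (\<i> * x) z (- cnj z) (\<i> * y)"
proof -
  have gJ: "g (J X) (J Y) = g X Y" for X Y using g by (simp add: hermitian_metric_def)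
  note bl = hermitian_alternating(1)[OF g J] and alt = hermitian_alternating(2)[OF g J]
  obtain x y :: real and z c where ex: "\<And>X Y. complex_of_real (g (J X) Y) = c * wedge_at h a X Y
       + \<i> * x * wedge_at h (cnj_form h) X Y + z * wedge_at h (cnj_form a) X Y - cnj z * wedge_at a (cnj_form h) X Y
       + \<i> * y * wedge_at a (cnj_form a) X Y + cnj c * wedge_at (cnj_form h) (cnj_form a) X Y"
    by (rule real_alternating_expand[OF cf bl alt]) (rule that)
  obtain e f where ef: "h e = 1" "a e = 0" "h f = 0" "a f = 1" using coframe_dual[OF cf] .
  have cc: "h (J X) = \<i> * h X" "a (J X) = \<i> * a X" for X
    using cf by (auto simp: coframe_def)
  have i: "g (J (J X)) (J Y) = g (J X) Y" for X Y by (rule gJ)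
  have "2 * (c + cnj c) = 0"
    using ex[of "J e" "J f"] ex[of e f] unfolding i by (simp add: wedge_at_def cnj_form_def ef cc algebra_simps)
  moreover have "2 * \<i> * (c - cnj c) = 0"
    using ex[of "J e" "J (J f)"] ex[of e "J f"] unfolding i by (simp add: wedge_at_def cnj_form_def ef cc algebra_simps)
  ultimately have c: "c = 0" by (auto simp: complex_eq_iff)
  have "complex_form (fundamental_form J g) Xs = form11 h a (\<i> * x) z (- cnj z) (\<i> * y) Xs" for Xs
  proof (cases "length Xs = 2")
    case True
    then obtain X Y where "Xs = [X, Y]" by (auto simp: eval_nat_numeral length_Suc_conv)
    then show ?thesis using ex[of X Y]
      by (simp add: complex_form_def fundamental_form_def form11_def wedge2_pair c)
  next
    case False
    then have "fundamental_form J g Xs = 0"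
      by (auto simp: fundamental_form_def split: list.splits)
    then show ?thesis using False by (simp add: complex_form_def form11_def wedge2_def tensor_eq)
  qed
  then show ?thesis by (intro that[of x z y] ext)
qed

lemma kahler_metric_exists:
  assumes nf: "normal_frame br J h a A C D F G" and J: "linear J" "\<And>X. J (J X) = - X"
  shows "\<exists>g. kahler_metric br J g"
proof -
  obtain x y :: real where cf: "coframe J h a" and
    se: "structure_eqs br h a 0 (complex_of_real A) 0 0 (complex_of_real C) D 0 F G 0" and
    xy: "x > 0" "y > 0" "x * C + y * (D - cnj G) = 0"
    using nf by (auto simp: normal_frame_def)
  have l: "linear h" "linear a" and c: "\<And>X. h (J X) = \<i> * h X" "\<And>X. a (J X) = \<i> * a X"
    and inj: "inj (\<lambda>X. (h X, a X))"
    using cf by (auto simp: coframe_def bij_is_inj)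
  \<comment> \<open>The factors 2 compensate \<open>Re w = (w + cnj w) / 2\<close>, so that the
    fundamental form is exactly the diagonal form with coefficients \<open>\<i> * x\<close> and
    \<open>\<i> * y\<close>.\<close>
  define g where "g X Y = 2 * x * Re (h X * cnj (h Y)) + 2 * y * Re (a X * cnj (a Y))" for X Y
  have "bilinear g"
    by (auto simp: bilinear_def g_def linear_add[OF l(1)] linear_add[OF l(2)] linear_scale[OF l(1)]
       linear_scale[OF l(2)] algebra_simps intro!: linearI)
  moreover have "g X Y = g Y X" for X Y by (simp add: g_def algebra_simps)
  moreover have "g X X > 0" if "X \<noteq> 0" for X
  proof -
    have "h X \<noteq> 0 \<or> a X \<noteq> 0"
      using injD[OF inj, of X 0] that by (auto simp: linear_0[OF l(1)] linear_0[OF l(2)])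
    moreover have "g X X = 2 * x * (cmod (h X))\<^sup>2 + 2 * y * (cmod (a X))\<^sup>2"
      unfolding g_def cmod_power2 by (simp add: power2_eq_square)
    ultimately show ?thesis using xy by (auto intro: add_pos_nonneg add_nonneg_pos)
  qed
  moreover have "g (J X) (J Y) = g X Y" for X Y by (simp add: g_def c algebra_simps)
  ultimately have hm: "hermitian_metric J g" by (simp add: hermitian_metric_def inner_product_def)
  have ff: "complex_of_real (fundamental_form J g Xs) = form11 h a (\<i> * x) 0 0 (\<i> * y) Xs" for Xs
  proof (cases "length Xs = 2")
    case True
    then obtain X Y where "Xs = [X, Y]" by (auto simp: eval_nat_numeral length_Suc_conv)
    then show ?thesis
      by (auto simp: fundamental_form_def form11_def wedge2_pair wedge_at_def cnj_form_def g_def c complex_eq_iff algebra_simps)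
  next
    case False
    then have "fundamental_form J g Xs = 0"
      by (auto simp: fundamental_form_def split: list.splits)
    then show ?thesis using False by (simp add: form11_def wedge2_def tensor_eq)
  qed
  \<comment> \<open>\<open>z1\<close> and \<open>z2\<close> are the (2,1)- and (1,2)-coefficients of
    the differential of this form.\<close>
  have z1: "\<i> * x * C + \<i> * y * (D - cnj G) = 0"
  proof -
    have "\<i> * x * C + \<i> * y * (D - cnj G) = \<i> * (x * C + y * (D - cnj G))" by (simp add: algebra_simps)
    then show ?thesis by (simp only: xy(3) mult_zero_right)
  qed
  have z2: "- (\<i> * x) * C + \<i> * y * (G - cnj D) = 0"
    using arg_cong[OF z1, of cnj] by (simp add: algebra_simps)
  have "ce_diff br (fundamental_form J g) Xs = 0" for Xs
  proof (cases "length Xs = 3")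
    case True
    then obtain X Y Z where Xs: "Xs = [X, Y, Z]" by (auto simp: list_length_3)
    have "complex_of_real (ce_diff br (fundamental_form J g) [X, Y, Z]) =
        ce_diff br (form11 h a (\<i> * x) 0 0 (\<i> * y)) [X, Y, Z]"
      by (simp add: ce_diff_3 ff)
    also have "\<dots> = 0"
      unfolding ce_diff_11[OF se] z1 z2 by (simp add: form21_def form12_def)
    finally show ?thesis by (simp add: Xs)
  next
    case False
    \<comment> \<open>On a list of length n the differential evaluates the form on lists of length n
      - 1. The truncated subtraction n - 2 is harmless, since a pair of indices i < j exists only
      for n at least 2.\<close>
    have "fundamental_form J g Ys = 0" if "length Ys \<noteq> 2" for Ys
      using that by (auto simp: fundamental_form_def split: list.splits)
    moreover have "length (br (Xs ! i) (Xs ! j) # nths Xs (- {i, j})) \<noteq> 2"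
      if "i < length Xs" "j \<in> {i<..<length Xs}" for i j
    proof -
      have "{k. k < length Xs \<and> k \<in> - {i, j}} = {..<length Xs} - {i, j}" by auto
      then have "length (nths Xs (- {i, j})) = length Xs - 2"
        using that by (simp add: length_nths card_Diff_subset)
      moreover have "length Xs \<ge> 2" using that by auto
      ultimately show ?thesis using False by simp
    qed
    ultimately show ?thesis by (simp add: ce_diff_def)
  qed
  then show ?thesis using hm by (auto simp: kahler_metric_def fun_eq_iff)
qed

text \<open>The fundamental form itself tames \<open>J\<close>, since its value on X, J X is the
  squared length of J X.\<close>

lemma kahler_imp_taming:
  assumes k: "kahler_metric br J g" and J: "linear J" "\<And>X. J (J X) = - X"
  shows "taming_symplectic_form br J (fundamental_form J g)"
proof -
  have hm: "hermitian_metric J g" using k by (simp add: kahler_metric_def)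
  then have gJ: "g (J X) (J Y) = g X Y" and gp: "X \<noteq> 0 \<Longrightarrow> g X X > 0" for X Y
    by (auto simp: hermitian_metric_def inner_product_def)
  note alt = hermitian_alternating(2)[OF hm J]
  have l: "linear (\<lambda>X. g (J X) Y)" "linear (\<lambda>Y. g (J X) Y)" for X Y
    using hermitian_alternating(1)[OF hm J] by (auto simp: bilinear_def)
  have "form 2 (fundamental_form J g)"
    unfolding form_def
  proof (intro conjI allI impI)
    fix Xs :: "'a list"
    assume "length Xs \<noteq> 2"
    then show "fundamental_form J g Xs = 0" by (auto simp: fundamental_form_def split: list.splits)
  next
    fix Xs :: "'a list" and i :: nat
    assume "length Xs = 2 \<and> i < 2"
    then show "linear (\<lambda>X. fundamental_form J g (Xs[i := X]))"
      by (auto simp: eval_nat_numeral length_Suc_conv less_Suc_eq fundamental_form_def l)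
  next
    fix Xs :: "'a list" and i j :: nat
    assume "length Xs = 2 \<and> i < j \<and> j < 2 \<and> Xs ! i = Xs ! j"
    then show "fundamental_form J g Xs = 0"
      by (auto simp: eval_nat_numeral length_Suc_conv less_Suc_eq fundamental_form_def alt)
  qed
  moreover have "fundamental_form J g [X, J X] > 0" if "X \<noteq> 0" for X
    using gp[OF that] by (simp add: fundamental_form_def gJ)
  ultimately show ?thesis using k by (simp add: taming_symplectic_form_def kahler_metric_def)
qed

lemma pq_form_20:
  assumes cf: "coframe J h a"
  shows "pq_form J 2 0 (\<lambda>Xs. c * wedge2 h a Xs)"
proof -
  have l: "linear h" "linear a" and cc: "\<And>X. h (J X) = \<i> * h X" "\<And>X. a (J X) = \<i> * a X"
    using cf by (auto simp: coframe_def)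
  have "form 2 (\<lambda>Xs. c * wedge2 h a Xs)"
    unfolding form_def
  proof (intro conjI allI impI)
    fix Xs :: "'a list"
    assume "length Xs \<noteq> 2"
    then show "c * wedge2 h a Xs = 0" by (simp add: wedge2_def tensor_eq)
  next
    fix Xs :: "'a list" and i :: nat
    assume "length Xs = 2 \<and> i < 2"
    then show "linear (\<lambda>X. c * wedge2 h a (Xs[i := X]))"
      by (auto simp: eval_nat_numeral length_Suc_conv less_Suc_eq wedge2_def linear_add[OF l(1)] linear_add[OF l(2)] linear_scale[OF l(1)]
       linear_scale[OF l(2)] algebra_simps intro!: linearI)
  next
    fix Xs :: "'a list" and i j :: nat
    assume "length Xs = 2 \<and> i < j \<and> j < 2 \<and> Xs ! i = Xs ! j"
    then show "c * wedge2 h a Xs = 0"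
      by (auto simp: eval_nat_numeral length_Suc_conv less_Suc_eq wedge2_def)
  qed
  moreover have "cext Zs (\<lambda>Xs. c * wedge2 h a Xs) = 0"
    if Zs: "length Zs = 2" "S \<subseteq> {..<2}" "card S \<noteq> 2" "\<And>i. i < 2 \<Longrightarrow> Zs ! i \<in> (if i \<in> S then T10 J else T01 J)" for Zs S
  proof -
    \<comment> \<open>Some argument is of type (0,1), and the complex extensions of \<open>h\<close>
      and \<open>a\<close> both annihilate it.\<close>
    have "\<not> {..<2} \<subseteq> S" using Zs(2,3) by (metis card_lessThan subset_antisym)
    then obtain i where i: "i < 2" "i \<notin> S" by auto
    obtain Z W where ZW: "Zs = [Z, W]" using Zs(1) by (auto simp: eval_nat_numeral length_Suc_conv)
    have van: "\<phi> (fst U) + \<i> * \<phi> (snd U) = 0" if "U \<in> T01 J" "\<phi> = h \<or> \<phi> = a" for U \<phi>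
    proof -
      have "snd U = J (fst U)" using that(1) by (auto simp: T01_def)
      then show ?thesis using that(2) by (auto simp: cc algebra_simps simp flip: mult.assoc)
    qed
    have "Zs ! i \<in> T01 J" using Zs(4)[OF i(1)] i(2) by simp
    then have "Z \<in> T01 J \<or> W \<in> T01 J" using i(1) by (auto simp: ZW less_2_cases_iff)
    moreover have "cext [Z, W] (\<lambda>Xs. c * wedge2 h a Xs) =
      c * ((h (fst Z) + \<i> * h (snd Z)) * (a (fst W) + \<i> * a (snd W)) - (a (fst Z) + \<i> * a (snd Z)) * (h (fst W) + \<i> * h (snd W)))"
      by (simp add: wedge2_def algebra_simps)
    ultimately show ?thesis using van[of Z h] van[of Z a] van[of W h] van[of W a] unfolding ZW by auto
  qed
  ultimately show ?thesis unfolding pq_form_def by auto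
qed

lemma skt_induces_taming:
  assumes nf: "normal_frame br J h a A C D F G" and J: "linear J" "\<And>X. J (J X) = - X"
    and skt: "skt_metric br J g"
  shows "induces_taming_symplectic_form br J g"
proof -
  have cf: "coframe J h a" and
    se: "structure_eqs br h a 0 (complex_of_real A) 0 0 (complex_of_real C) D 0 F G 0" and
    alt: "A = 0 \<and> C = 0 \<and> D = 0 \<and> F = 0 \<and> G = 0 \<or>
     A + G \<noteq> 0 \<and> (C = 0 \<and> D = cnj G \<or> A + cnj G - D \<noteq> 0)"
    using nf by (auto simp: normal_frame_def)
  have hm: "hermitian_metric J g" and
    dd: "del br J (delbar br J (complex_form (fundamental_form J g))) = (\<lambda>_. 0)"
    using skt by (auto simp: skt_metric_def)
  obtain x y :: real and z where ff:
    "complex_form (fundamental_form J g) = form11 h a (\<i> * x) z (- cnj z) (\<i> * y)"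
    by (rule hermitian_form11[OF cf J hm])
  define P where "P = z * cnj F - cnj z * (D - A)"
  define Q where "Q = \<i> * x * C + \<i> * y * (D - cnj G)"
  have d: "del br J (complex_form (fundamental_form J g)) = form21 h a P Q"
    unfolding ff del_11[OF cf se] P_def Q_def by simp
  \<comment> \<open>The SKT condition has a single coefficient, at the volume form; evaluation on
    \<open>e\<close>, \<open>J e\<close>, \<open>f\<close>, \<open>J f\<close> extracts it.\<close>
  have "Q * (A + cnj G - D) = 0"
  proof -
    obtain e f where ef: "h e = 1" "a e = 0" "h f = 0" "a f = 1" using coframe_dual[OF cf] .
    have cc: "h (J X) = \<i> * h X" "a (J X) = \<i> * a X" for X using cf by (auto simp: coframe_def)
    have cQ: "- (\<i> * x) * C + \<i> * y * (G - cnj D) = cnj Q" by (simp add: Q_def algebra_simps)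
    have "- cnj Q * (A + cnj G - D) * wedge4 h a (cnj_form h) (cnj_form a) [e, J e, f, J f] = 0"
      using fun_cong[OF dd, of "[e, J e, f, J f]"] unfolding ff del_11(2)[OF cf se] del_12[OF cf se] cQ by simp
    moreover have "wedge4 h a (cnj_form h) (cnj_form a) [e, J e, f, J f] \<noteq> 0"
      by (simp add: wedge4_def wedge4_at_def cnj_form_def ef cc)
    ultimately show ?thesis by auto
  qed
  then obtain c where c: "P = - c * (A + G)" and Q: "Q = 0"
  proof -
    assume *: "Q * (A + cnj G - D) = 0"
    from alt show thesis
    proof
      assume "A = 0 \<and> C = 0 \<and> D = 0 \<and> F = 0 \<and> G = 0"
      then show thesis by (intro that[of 0]) (auto simp: P_def Q_def)
    next
      assume a: "A + G \<noteq> 0 \<and> (C = 0 \<and> D = cnj G \<or> A + cnj G - D \<noteq> 0)"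
      \<comment> \<open>\<open>Q\<close> vanishes identically if \<open>C = 0\<close> and
        \<open>D = cnj G\<close>, and by the SKT condition otherwise. The witness for
        \<open>c\<close> then solves \<open>P = - c * (A + G)\<close>, where the right-hand side is
        the coefficient in \<open>delbar\<close> of c h \<and> a.\<close>
      then have "Q = 0" using * by (auto simp: Q_def)
      then show thesis using a by (intro that[of "- P / (A + G)"]) auto
    qed
  qed
  show ?thesis unfolding induces_taming_symplectic_form_def
  proof (intro exI conjI)
    show "pq_form J 2 0 (\<lambda>Xs. c * wedge2 h a Xs)" by (rule pq_form_20[OF cf])
    show "del br J (\<lambda>Xs. c * wedge2 h a Xs) = (\<lambda>_. 0)" by (rule del_20[OF cf se])
    show "del br J (complex_form (fundamental_form J g)) = delbar br J (\<lambda>Xs. c * wedge2 h a Xs)"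
      unfolding d del_20[OF cf se] c Q by simp
  qed
qed

theorem proposition4p2:
  fixes br :: "'a::real_vector \<Rightarrow> 'a \<Rightarrow> 'a"
    and J :: "'a \<Rightarrow> 'a"
  assumes "lie_algebra br"
    and "dim (UNIV :: 'a set) = 4"
    and "complex_structure br J"
  shows "((\<exists>\<Omega>. taming_symplectic_form br J \<Omega>) \<longleftrightarrow> (\<exists>g. kahler_metric br J g)) \<and>
         ((\<exists>g. kahler_metric br J g) \<longrightarrow>
            (\<forall>g. skt_metric br J g \<longrightarrow> induces_taming_symplectic_form br J g))"
proof -
  have J: "linear J" "\<And>X. J (J X) = - X" using assms(3) by (auto simp: complex_structure_def)
  \<comment> \<open>The frame is obtained from any taming form. A Kaehler metric supplies one, so
    both parts of the theorem rest on the same frames.\<close>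
  have frame: "\<exists>h a A C D F G. normal_frame br J h a A C D F G" if "taming_symplectic_form br J \<Omega>" for \<Omega>
    by (rule normal_frame_exists[OF assms that]) blast
  show ?thesis
  proof (intro conjI iffI impI allI)
    assume "\<exists>\<Omega>. taming_symplectic_form br J \<Omega>"
    then show "\<exists>g. kahler_metric br J g" using frame kahler_metric_exists[OF _ J] by blast
  next
    assume "\<exists>g. kahler_metric br J g"
    then show "\<exists>\<Omega>. taming_symplectic_form br J \<Omega>" using kahler_imp_taming[OF _ J] by blast
  next
    fix g assume "\<exists>g. kahler_metric br J g" "skt_metric br J g"
    then show "induces_taming_symplectic_form br J g"
      using kahler_imp_taming[OF _ J] frame skt_induces_taming[OF _ J] by blast
  qed
qed

end
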